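(* Up to projective equivalence (under $\mathrm{P\Gamma L}(9,2)$) there are exactly two $3$-dimensional pseudo-ovals in $\mathrm{PG}(8,2)$, and each of them is elementary: one arises from a conic $\mathcal C$ of $\mathrm{PG}(2,8)$ and the other from a pointed conic $\mathcal{PC}$ of $\mathrm{PG}(2,8)$.
   Context: A $3$-dimensional pseudo-oval in $\mathrm{PG}(8,2)$ is a set of $9$ projective planes of $\mathrm{PG}(8,2)$ any three of which span $\mathrm{PG}(8,2)$. Identifying $\mathrm{GF}(2)^9$ with $\mathrm{GF}(8)^3$ as $\mathrm{GF}(2)$-vector spaces, each point of $\mathrm{PG}(2,8)$ becomes a plane of $\mathrm{PG}(8,2)$, and an oval of $\mathrm{PG}(2,8)$ (9 points, no three collinear) becomes a $3$-dimensional pseudo-oval, called elementary and said to arise from that oval. A conic is a nondegenerate conic of $\mathrm{PG}(2,8)$, e.g. $\{(1,t,t^{1/2}):t\in\mathrm{GF}(8)\}\cup\{(0,1,0)\}$; a pointed conic is the oval obtained from a conic by deleting one point and adding the nucleus of the conic, e.g. $\{(1,t,t^2):t\in\mathrm{GF}(8)\}\cup\{(0,1,0)\}$. *)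

theory Defs
  imports "HOL-Analysis.Finite_Cartesian_Product" "HOL-Library.Z2"
begin

text \<open>GF(2) is the library type bit.  GF(8) is modelled as bit^3 = GF(2)[x]/(x^3+x+1),
  coefficient a$0 + a$1 x + a$2 x^2.  Addition is componentwise (library).\<close>

type_synonym gf8 = "bit ^ 3"

definition gf8_mul :: "gf8 \<Rightarrow> gf8 \<Rightarrow> gf8" where
  "gf8_mul a b = (let
      d0 = a$0 * b$0;
      d1 = a$0 * b$1 + a$1 * b$0;
      d2 = a$0 * b$2 + a$1 * b$1 + a$2 * b$0;
      d3 = a$1 * b$2 + a$2 * b$1;
      d4 = a$2 * b$2
    in (\<chi> i. if i = 0 then d0 + d3 else if i = 1 then d1 + d3 + d4 else d2 + d4))"

definition gf8_one :: gf8 where "gf8_one = (\<chi> i. if i = 0 then 1 else 0)"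

definition gf8_sq :: "gf8 \<Rightarrow> gf8" where "gf8_sq t = gf8_mul t t"

definition gf8_sqrt :: "gf8 \<Rightarrow> gf8" where "gf8_sqrt t = gf8_sq (gf8_sq t)"

text \<open>The GF(2)-vector space GF(8)^3 = GF(2)^9; PG(8,2) lives on it.\<close>
type_synonym V = "gf8 ^ 3"

definition vec3 :: "gf8 \<Rightarrow> gf8 \<Rightarrow> gf8 \<Rightarrow> V" where
  "vec3 a b c = (\<chi> i. if i = 0 then a else if i = 1 then b else c)"

text \<open>A projective plane of PG(8,2) = a 3-dimensional GF(2)-subspace of GF(2)^9
  (over GF(2), subspaces are exactly additively closed sets containing 0).\<close>
definition is_plane :: "V set \<Rightarrow> bool" where
  "is_plane S \<longleftrightarrow> 0 \<in> S \<and> (\<forall>x\<in>S. \<forall>y\<in>S. x + y \<in> S) \<and> card S = 8"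

definition spans_all3 :: "V set \<Rightarrow> V set \<Rightarrow> V set \<Rightarrow> bool" where
  "spans_all3 A B C \<longleftrightarrow> {a + b + c | a b c. a \<in> A \<and> b \<in> B \<and> c \<in> C} = UNIV"

definition pseudo_oval :: "V set set \<Rightarrow> bool" where
  "pseudo_oval Ov \<longleftrightarrow> card Ov = 9 \<and> (\<forall>S\<in>Ov. is_plane S) \<and>
     (\<forall>A\<in>Ov. \<forall>B\<in>Ov. \<forall>C\<in>Ov. A \<noteq> B \<and> A \<noteq> C \<and> B \<noteq> C \<longrightarrow> spans_all3 A B C)"

text \<open>Projective equivalence under P\<Gamma>L(9,2): since GF(2) has only the trivial
  automorphism and trivial scalars, P\<Gamma>L(9,2) = GL(9,2), i.e. additive bijections.\<close>
definition proj_equiv :: "V set set \<Rightarrow> V set set \<Rightarrow> bool" where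
  "proj_equiv O1 O2 \<longleftrightarrow> (\<exists>g :: V \<Rightarrow> V. bij g \<and> (\<forall>x y. g (x + y) = g x + g y) \<and>
      O2 = (\<lambda>S. g ` S) ` O1)"

text \<open>The plane of PG(8,2) corresponding to a point P of PG(2,8): the GF(8)-span of P.\<close>
definition pt_plane :: "V \<Rightarrow> V set" where
  "pt_plane P = {(\<chi> i. gf8_mul l (P$i)) | l. True}"

definition elementary :: "V set \<Rightarrow> V set set" where
  "elementary K = pt_plane ` K"

definition conic :: "V set" where
  "conic = {vec3 gf8_one t (gf8_sqrt t) | t. True} \<union> {vec3 0 gf8_one 0}"

definition pointed_conic :: "V set" where
  "pointed_conic = {vec3 gf8_one t (gf8_sq t) | t. True} \<union> {vec3 0 gf8_one 0}"

end

theory Submission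
  imports Defs "HOL-Analysis.Cartesian_Space"
begin

text \<open>
  Take three planes of a pseudo-oval as coordinate axes and a fourth one as the diagonal of
  \<open>GF(8)\<^sup>3\<close>. The other five are graphs \<open>{(x, A x, B x)}\<close> of additive maps of \<open>GF(8)\<close>, and the
  spanning condition says that various pairs of such maps differ at every nonzero argument.
  An additive map without eigenvalues 0 and 1 has an irreducible characteristic polynomial, so a
  change of basis makes one of the \<open>A\<close>'s the multiplication by an element \<open>s\<close> of \<open>GF(8)\<close>.
  There are only 12 additive maps that differ everywhere from 0, the identity and \<open>s\<close>; five
  of them are multiplications, and each of the other seven agrees somewhere with every other
  one of the 12. Hence all \<open>A\<close>'s are multiplications. Three of the \<open>B\<close>'s, combined with the
  conditions on \<open>B A\<^sup>-\<^sup>1\<close>, likewise force all \<open>B\<close>'s to be multiplications. The pseudo-oval is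
  therefore elementary, and a search over the ovals through a frame of \<open>PG(2,8)\<close> shows that
  each of them is a conic or a pointed conic.

  The two are distinguished by their translation elements, the members \<open>E\<close> such that any
  three other members form with some fourth one a quadrangle whose diagonal line contains \<open>E\<close>.
  All members of a conic are of this kind, but only one member of a pointed conic.
\<close>

section \<open>The field with eight elements\<close>

text \<open>An isomorphic copy of \<open>gf8\<close> on truth values. It can be enumerated, so
  statements quantified over the whole field can be settled by evaluation.\<close>

datatype f8 = F bool bool bool

instantiation f8 :: enum
begin
definition "enum_f8 = [F a b c. a \<leftarrow> [False, True], b \<leftarrow> [False, True], c \<leftarrow> [False, True]]"
definition "enum_all_f8 P \<longleftrightarrow> list_all P (Enum.enum :: f8 list)"
definition "enum_ex_f8 P \<longleftrightarrow> list_ex P (Enum.enum :: f8 list)"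
instance
proof
  show *: "(UNIV :: f8 set) = set Enum.enum"
  proof (intro set_eqI iffI UNIV_I)
    fix x :: f8
    obtain a b c where "x = F a b c" by (cases x)
    then show "x \<in> set Enum.enum"
      by (cases a; cases b; cases c) (simp_all add: enum_f8_def)
  qed
  show "distinct (Enum.enum :: f8 list)" by (simp add: enum_f8_def)
  show "Enum.enum_all P = Ball UNIV P" for P :: "f8 \<Rightarrow> bool"
    by (simp add: * enum_all_f8_def list_all_iff)
  show "Enum.enum_ex P = Bex UNIV P" for P :: "f8 \<Rightarrow> bool"
    by (simp add: * enum_ex_f8_def list_ex_iff)
qed
end

instantiation f8 :: "{zero, one, plus, times, minus, uminus, inverse}"
begin
definition "0 = F False False False"
definition "1 = F True False False"
fun plus_f8 where "F a b c + F a' b' c' = F (a \<noteq> a') (b \<noteq> b') (c \<noteq> c')"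
definition "- x = (x :: f8)"
definition "x - y = x + (y :: f8)"
text \<open>\<open>F a b c\<close> stands for a + b x + c x^2, with x^3 = x + 1 and x^4 = x^2 + x
  used for the reduction; inequality of truth values is addition modulo 2.\<close>

fun times_f8 where "F a b c * F a' b' c' =
  F ((a \<and> a') \<noteq> ((b \<and> c') \<noteq> (c \<and> b')))
    ((((a \<and> b') \<noteq> (b \<and> a')) \<noteq> ((b \<and> c') \<noteq> (c \<and> b'))) \<noteq> (c \<and> c'))
    ((((a \<and> c') \<noteq> (b \<and> b')) \<noteq> (c \<and> a')) \<noteq> (c \<and> c'))"
text \<open>The sixth power: the multiplicative group has order 7, and 0 is sent to 0 as the class
  \<open>field\<close> demands.\<close>

definition "inverse x = x * x * (x * x) * (x * (x :: f8))"
definition "x div y = x * inverse (y :: f8)"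
instance ..
end

lemma f8_laws:
  "\<forall>a b c :: f8. a + b + c = a + (b + c)"
  "\<forall>a b :: f8. a + b = b + a"
  "\<forall>a b c :: f8. a * b * c = a * (b * c)"
  "\<forall>a b :: f8. a * b = b * a"
  "\<forall>a b c :: f8. (a + b) * c = a * c + b * c"
  "\<forall>a :: f8. 0 + a = a \<and> 1 * a = a \<and> - a + a = 0 \<and> (a \<noteq> 0 \<longrightarrow> inverse a * a = 1)"
  "0 \<noteq> (1 :: f8)" "inverse 0 = (0 :: f8)"
  by code_simp+

instance f8 :: field
  by intro_classes (use f8_laws in \<open>auto simp: minus_f8_def uminus_f8_def divide_f8_def\<close>)

lemma f8_add_self [simp]: "x + x = (0 :: f8)"
  by (metis add.left_inverse uminus_f8_def)

lemma f8_add_eq_0_iff: "x + y = 0 \<longleftrightarrow> x = (y :: f8)"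
  by (metis add_eq_0_iff uminus_f8_def)

lemma card_f8: "card (UNIV :: f8 set) = 8"
  by (simp add: card_UNIV_length_enum enum_f8_def)

abbreviation alpha :: f8 where "alpha \<equiv> F False True False"

section \<open>Additive maps of the field\<close>

type_synonym W = "f8 \<times> f8 \<times> f8"

text \<open>The triple lists the images of the basis 1, \<open>alpha\<close>,
  \<open>alpha * alpha\<close>. Every additive map arises in this way, so quantifying over
  \<open>W\<close> covers all 512 of them.\<close>

fun amap :: "W \<Rightarrow> f8 \<Rightarrow> f8" where
  "amap (u, v, w) (F a b c) = (if a then u else 0) + (if b then v else 0) + (if c then w else 0)"

text \<open>For additive maps this says that \<open>f + g\<close> is invertible, or that the graphs
  of \<open>f\<close> and \<open>g\<close> meet only in 0.\<close>

definition disagree :: "(f8 \<Rightarrow> f8) \<Rightarrow> (f8 \<Rightarrow> f8) \<Rightarrow> bool" where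
  "disagree f g \<longleftrightarrow> (\<forall>x. x \<noteq> 0 \<longrightarrow> f x \<noteq> g x)"

text \<open>The finite searches below are evaluated by rewriting, which evaluates both sides of a
  conjunction and works under binders. Conditionals, \<^const>\<open>find\<close> and matching on \<^const>\<open>F\<close>
  keep failed branches and bodies with symbolic arguments from being unfolded.\<close>

lemma disagree_code [code]:
  "disagree f g \<longleftrightarrow> find (\<lambda>x. x \<noteq> 0 \<and> f x = g x) Enum.enum = None"
  by (auto simp: disagree_def find_None_iff enum_UNIV)

fun candidate_values :: "f8 \<Rightarrow> f8 \<Rightarrow> f8 list" where
  "candidate_values (F a b c) x =
     filter (\<lambda>y. y \<noteq> 0 \<and> y \<noteq> x \<and> y \<noteq> F a b c * x) Enum.enum"

text \<open>Filtering the values at the three basis elements first leaves five choices for each when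
  the slope is neither 0 nor 1; only these 125 triples undergo the full tests.\<close>

fun candidates :: "f8 \<Rightarrow> W list" where
  "candidates (F a b c) =
     [(u, v, w). u \<leftarrow> candidate_values (F a b c) 1,
                 v \<leftarrow> candidate_values (F a b c) alpha,
                 w \<leftarrow> candidate_values (F a b c) (alpha * alpha),
                 if disagree (amap (u, v, w)) (\<lambda>x. 0)
                 then if disagree (amap (u, v, w)) (\<lambda>x. x)
                      then disagree (amap (u, v, w)) (\<lambda>x. F a b c * x) else False
                 else False]"

definition scalar :: "W \<Rightarrow> bool" where
  "scalar p \<longleftrightarrow> (\<forall>x. amap p x = amap p 1 * x)"

text \<open>The pair \<open>(s, p)\<close> stands for the plane of all (x, s x,
  \<open>amap p x\<close>). The first test is independence of the two planes from the axis (0, 1,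
  0), the second from the axis (1, 0, 0): equal second coordinates s x = t y are parametrized by x =
  t z, y = s z.\<close>

fun compatible :: "f8 \<times> W \<Rightarrow> f8 \<times> W \<Rightarrow> bool" where
  "compatible (s, p) (t, q) \<longleftrightarrow>
     (if disagree (amap p) (amap q)
      then disagree (\<lambda>z. amap p (t * z)) (\<lambda>z. amap q (s * z)) else False)"

definition slopes :: "f8 list" where
  "slopes = filter (\<lambda>t. t \<noteq> 0 \<and> t \<noteq> 1) Enum.enum"

text \<open>Without the eigenvalues 0 and 1, the characteristic polynomial is X^3 + X + 1 or X^3 +
  X^2 + 1, the minimal polynomials of \<open>alpha\<close> and \<open>alpha + 1\<close>. As it is
  irreducible, 1 is a cyclic vector. The maps \<open>i\<close> and \<open>j\<close> send the powers
  1, s, s^2 of the respective root s to 1, \<open>a\<close>, \<open>b\<close>, the iterated images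
  of 1.\<close>

lemma amap_conjugate_scalar:
  "\<forall>p. disagree (amap p) (\<lambda>x. 0) \<and> disagree (amap p) (\<lambda>x. x) \<longrightarrow>
     (let a = amap p 1; b = amap p a; i = amap (1, a, b); j = amap (1, a + 1, b + 1) in
       (\<forall>x. amap p (i x) = i (alpha * x)) \<and> disagree i (\<lambda>x. 0) \<or>
       (\<forall>x. amap p (j x) = j ((alpha + 1) * x)) \<and> disagree j (\<lambda>x. 0))"
  by code_simp

text \<open>Conjugation leaves just these two slopes, one for each irreducible cubic. A map that is
  not a multiplication could not coexist with any other candidate.\<close>

lemma candidates_scalar_if_disagree:
  "list_all (\<lambda>s. let cs = candidates s in
     list_all (\<lambda>p. if scalar p then True
       else list_all (\<lambda>q. \<not> disagree (amap p) (amap q)) cs) cs) [alpha, alpha + 1]"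
  by code_simp

text \<open>Join two pairs when their slopes differ and they are \<open>compatible\<close>. A pair
  whose map is not a multiplication then lies in no triangle; \<open>R\<close> is its set of
  neighbours.\<close>

lemma candidates_scalar_if_compatible:
  "let T = [(t, q). t \<leftarrow> slopes, q \<leftarrow> candidates t] in
     list_all (\<lambda>(s, p). if scalar p then True else
       let R = filter (\<lambda>(t, q). if t = s then False else compatible (s, p) (t, q)) T in
         list_all (\<lambda>(t, q). list_all (\<lambda>(u, r). t = u \<or> \<not> compatible (t, q) (u, r)) R) R) T"
  by code_simp

section \<open>Arcs in the plane over the field\<close>

fun smul :: "f8 \<Rightarrow> W \<Rightarrow> W" where
  "smul l (x, y, z) = (l * x, l * y, l * z)"

fun det :: "W \<Rightarrow> W \<Rightarrow> W \<Rightarrow> f8" where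
  "det (a, b, c) (d, e, f) (g, h, i) =
     a * (e * i + f * h) + b * (d * i + f * g) + c * (d * h + e * g)"

fun lin :: "W \<times> W \<times> W \<Rightarrow> W \<Rightarrow> W" where
  "lin (p, q, r) (x, y, z) = smul x p + smul y q + smul z r"

fun normalize_point :: "W \<Rightarrow> W" where
  "normalize_point (x, y, z) =
     (if x \<noteq> 0 then (1, y / x, z / x) else if y \<noteq> 0 then (0, 1, z / y) else (0, 0, 1))"

text \<open>Images are compared after normalization, so \<open>L\<close> is meant to list points
  whose first nonzero coordinate is 1.\<close>

fun carries :: "W \<times> W \<times> W \<Rightarrow> W list \<Rightarrow> W list \<Rightarrow> bool" where
  "carries (p, q, r) K L \<longleftrightarrow>
     (if det p q r = 0 then False
      else find (\<lambda>x. normalize_point (lin (p, q, r) x) \<notin> set L) K = None)"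

text \<open>The columns of the matrix that takes the unit points to \<open>p\<close>, \<open>q\<close>, \<open>r\<close> and \<open>(1, 1, 1)\<close>
  to \<open>s\<close>, by Cramer's rule.\<close>

definition frame_matrix :: "W \<Rightarrow> W \<Rightarrow> W \<Rightarrow> W \<Rightarrow> W \<times> W \<times> W" where
  "frame_matrix p q r s = (smul (det s q r) p, smul (det p s r) q, smul (det p q s) r)"

text \<open>In GF(8) the fourth power is the square root, because t^8 = t. The points form the conic
  z^2 = x y with nucleus (0, 0, 1).\<close>

definition conic_points :: "W list" where
  "conic_points = (0, 1, 0) # map (\<lambda>t. (1, t, (t * t) * (t * t))) Enum.enum"

definition pointed_conic_points :: "W list" where
  "pointed_conic_points = (0, 1, 0) # map (\<lambda>t. (1, t, t * t)) Enum.enum"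

definition oval_points :: "(f8 \<times> f8) list \<Rightarrow> W list" where
  "oval_points pts = (1, 0, 0) # (0, 1, 0) # (0, 0, 1) # map (\<lambda>(t, y). (1, t, y)) pts"

text \<open>The new point (1, t, y) must not be collinear with two earlier points. Besides
  \<open>y \<noteq> 0\<close>, the tests concern an earlier point together with (0, 1, 0), the same
  with (1, 0, 0), and finally two earlier points, where the expression is their determinant with the
  new one. Lines through (0, 0, 1) cause no trouble since the slopes are distinct.\<close>

fun extends_arc :: "(f8 \<times> f8) list \<Rightarrow> f8 \<Rightarrow> f8 \<Rightarrow> bool" where
  "extends_arc pts t (F a b c) \<longleftrightarrow> (let y = F a b c in
     y \<noteq> 0 \<and> (\<forall>(t', y') \<in> set pts. y \<noteq> y' \<and> t' * y \<noteq> t * y' \<and>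
       (\<forall>(t'', y'') \<in> set pts. t' \<noteq> t'' \<longrightarrow>
          (t'' + t') * y + (t'' + t) * y' + (t' + t) * y'' \<noteq> 0)))"

fun search :: "((f8 \<times> f8) list \<Rightarrow> bool) \<Rightarrow> (f8 \<times> f8) list \<Rightarrow> f8 list \<Rightarrow> bool" where
  "search P pts [] \<longleftrightarrow> P pts"
| "search P pts (t # ts) \<longleftrightarrow>
     (\<forall>y. if extends_arc pts t y then search P ((t, y) # pts) ts else True)"

text \<open>Nine points \<open>oval_points pts\<close> that miss the slope \<open>m\<close> extend to a hyperoval by
  \<open>Q = (1, m, n)\<close>, where \<open>n\<close> is the missing ordinate: all field elements add up to \<open>0\<close>.
  Either \<open>Q\<close> is the nucleus of a conic, or some point \<open>N\<close> of the oval is the nucleus of the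
  conic formed by the other nine points of the hyperoval.\<close>

definition is_conic_or_pointed :: "f8 \<Rightarrow> (f8 \<times> f8) list \<Rightarrow> bool" where
  "is_conic_or_pointed m pts \<longleftrightarrow> (let Q = (1, m, sum_list (map snd pts)); K = oval_points pts in
     if carries (frame_matrix (1, 0, 0) (0, 1, 0) Q (0, 0, 1)) conic_points K then True
     else find (\<lambda>N. case remove1 N K of
       p # r # _ \<Rightarrow> carries (frame_matrix p N Q r) pointed_conic_points K) K \<noteq> None)"

definition all_ovals_classified :: "f8 \<Rightarrow> bool" where
  "all_ovals_classified m \<longleftrightarrow> search (is_conic_or_pointed m) [(1, 1)] (remove1 m slopes)"

text \<open>Every hyperoval of PG(2,8) is a conic with its nucleus. The group of a conic is
  transitive on ordered triples of its points, so any three of them together with the nucleus give a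
  frame that determines a suitable matrix. In \<open>pointed_conic_points\<close> the underlying
  conic is y^2 = x z, with (0, 0, 1) replaced by the nucleus (0, 1, 0). The six cases are the
  possible missing slopes.\<close>

lemma oval_classification:
  "all_ovals_classified (F False True False)" "all_ovals_classified (F True True False)"
  "all_ovals_classified (F False False True)" "all_ovals_classified (F True False True)"
  "all_ovals_classified (F False True True)" "all_ovals_classified (F True True True)"
  by code_simp+

lemma conic_points_arc:
  "\<forall>p \<in> set conic_points. \<forall>q \<in> set conic_points. \<forall>r \<in> set conic_points.
     p \<noteq> q \<and> p \<noteq> r \<and> q \<noteq> r \<longrightarrow> det p q r \<noteq> 0"
  by code_simp

lemma pointed_conic_points_arc:
  "\<forall>p \<in> set pointed_conic_points. \<forall>q \<in> set pointed_conic_points. \<forall>r \<in> set pointed_conic_points.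
     p \<noteq> q \<and> p \<noteq> r \<and> q \<noteq> r \<longrightarrow> det p q r \<noteq> 0"
  by code_simp

text \<open>Exchanging x and y preserves z^2 = x y. This symmetry transports the translation
  property from (0, 1, 0) to (1, 0, 0).\<close>

lemma conic_swap_carries: "carries ((0, 1, 0), (1, 0, 0), (0, 0, 1)) conic_points conic_points"
  by code_simp

section \<open>Pseudo-ovals up to additive bijections\<close>

definition plane :: "'a::ab_group_add set \<Rightarrow> bool" where
  "plane S \<longleftrightarrow> 0 \<in> S \<and> (\<forall>x\<in>S. \<forall>y\<in>S. x + y \<in> S) \<and> card S = 8"

text \<open>Independence replaces spanning because injective additive maps visibly preserve it, and
  a single relation between three planes refutes it. Working in an arbitrary abelian group serves
  both \<open>V\<close> and \<open>W\<close>.\<close>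

definition independent3 :: "'a::ab_group_add set \<Rightarrow> 'a set \<Rightarrow> 'a set \<Rightarrow> bool" where
  "independent3 A B C \<longleftrightarrow> (\<forall>a\<in>A. \<forall>b\<in>B. \<forall>c\<in>C. a + b + c = 0 \<longrightarrow> a = 0 \<and> b = 0 \<and> c = 0)"

definition gen_pseudo_oval :: "'a::ab_group_add set set \<Rightarrow> bool" where
  "gen_pseudo_oval Ov \<longleftrightarrow> card Ov = 9 \<and> (\<forall>S\<in>Ov. plane S) \<and>
     (\<forall>A\<in>Ov. \<forall>B\<in>Ov. \<forall>C\<in>Ov. A \<noteq> B \<and> A \<noteq> C \<and> B \<noteq> C \<longrightarrow> independent3 A B C)"

definition lin_equiv :: "'a::ab_group_add set set \<Rightarrow> 'b::ab_group_add set set \<Rightarrow> bool" where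
  "lin_equiv O1 O2 \<longleftrightarrow> (\<exists>g. bij g \<and> additive g \<and> O2 = image g ` O1)"

lemma additive_inv:
  assumes "bij g" "additive g"
  shows "additive (inv g)"
proof
  fix x y
  have "g (inv g x + inv g y) = x + y"
    using assms by (simp add: additive.add bij_is_surj surj_f_inv_f)
  then show "inv g (x + y) = inv g x + inv g y"
    using assms(1) by (metis bij_inv_eq_iff)
qed

lemma lin_equiv_sym:
  assumes "lin_equiv O1 O2"
  shows "lin_equiv O2 O1"
proof -
  obtain g where g: "bij g" "additive g" "O2 = image g ` O1"
    using assms by (auto simp: lin_equiv_def)
  have "image (inv g) ` O2 = O1"
    using g(1) by (simp add: g(3) image_image bij_is_inj)
  then show ?thesis
    unfolding lin_equiv_def using g additive_inv bij_imp_bij_inv by metis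
qed

lemma lin_equiv_trans:
  assumes "lin_equiv O1 O2" "lin_equiv O2 O3"
  shows "lin_equiv O1 O3"
proof -
  obtain g h where g: "bij g" "additive g" "O2 = image g ` O1"
    and h: "bij h" "additive h" "O3 = image h ` O2"
    using assms by (auto simp: lin_equiv_def)
  have "additive (h \<circ> g)"
    using g(2) h(2) by (simp add: additive_def)
  moreover have "O3 = image (h \<circ> g) ` O1"
    by (simp add: g(3) h(3) image_image image_comp)
  ultimately show ?thesis
    unfolding lin_equiv_def using g(1) h(1) bij_comp by metis
qed

lemma plane_image:
  assumes "inj g" "additive g" "plane S"
  shows "plane (g ` S)"
  using assms unfolding plane_def
  by (auto simp: card_image inj_on_subset image_iff Bex_def simp flip: additive.add)
    (metis additive.zero)

lemma independent3_image:
  assumes "inj g" "additive g" "independent3 A B C"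
  shows "independent3 (g ` A) (g ` B) (g ` C)"
proof -
  have "g x = 0 \<longleftrightarrow> x = 0" for x
    using assms(1) additive.zero[OF assms(2)] by (metis injD)
  then show ?thesis
    using assms(3) unfolding independent3_def
    by (simp flip: additive.add[OF assms(2)])
qed

lemma gen_pseudo_oval_lin_equiv:
  assumes "lin_equiv O1 O2" "gen_pseudo_oval O1"
  shows "gen_pseudo_oval O2"
proof -
  obtain g where g: "bij g" "additive g" "O2 = image g ` O1"
    using assms by (auto simp: lin_equiv_def)
  have "inj g" using g(1) by (rule bij_is_inj)
  then have "inj (image g)" by (simp add: inj_image_eq_iff inj_def)
  then have "card O2 = card O1"
    by (simp add: g(3) card_image inj_on_subset)
  moreover have "\<forall>S\<in>O2. plane S"
    using assms(2) plane_image[OF \<open>inj g\<close> g(2)] by (simp add: gen_pseudo_oval_def g(3))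
  moreover have "independent3 (g ` A) (g ` B) (g ` C)"
    if "A \<in> O1" "B \<in> O1" "C \<in> O1" "g ` A \<noteq> g ` B" "g ` A \<noteq> g ` C" "g ` B \<noteq> g ` C" for A B C
  proof (rule independent3_image[OF \<open>inj g\<close> g(2)])
    have "A \<noteq> B" "A \<noteq> C" "B \<noteq> C" using that by metis+
    then show "independent3 A B C" using assms(2) that(1-3) by (simp add: gen_pseudo_oval_def)
  qed
  ultimately show ?thesis
    using assms(2) unfolding gen_pseudo_oval_def g(3) by (simp add: ball_simps)
qed

text \<open>The sum map from \<open>A \<times> B \<times> C\<close> to the group goes between sets
  of size 8^3 = 512, so it is onto exactly if it is injective. Differences are sums here, hence
  injectivity amounts to a trivial kernel.\<close>

lemma independent3_iff_spanning:
  fixes A B C :: "'a::ab_group_add set"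
  assumes char2: "\<And>x :: 'a. x + x = 0" and card: "card (UNIV :: 'a set) = 512"
    and planes: "plane A" "plane B" "plane C"
  shows "independent3 A B C \<longleftrightarrow> {a + b + c | a b c. a \<in> A \<and> b \<in> B \<and> c \<in> C} = UNIV"
proof -
  define f :: "'a \<times> 'a \<times> 'a \<Rightarrow> 'a" where "f = (\<lambda>(a, b, c). a + b + c)"
  have fin: "finite (UNIV :: 'a set)" using card by (metis card.infinite zero_neq_numeral)
  have cardP: "card (A \<times> B \<times> C) = 512"
    using planes by (simp add: plane_def card_cartesian_product)
  have finP: "finite (A \<times> B \<times> C)" using cardP by (metis card.infinite zero_neq_numeral)
  have eqI: "x = y" if "x + y = 0" for x y :: 'a
    using that char2[of y] by (metis add_right_cancel)
  have im: "{a + b + c | a b c. a \<in> A \<and> b \<in> B \<and> c \<in> C} = f ` (A \<times> B \<times> C)"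
    by (auto simp: f_def image_def)
  show ?thesis
  proof
    assume ind: "independent3 A B C"
    have "inj_on f (A \<times> B \<times> C)"
    proof (rule inj_onI)
      fix p q assume "p \<in> A \<times> B \<times> C" "q \<in> A \<times> B \<times> C" "f p = f q"
      then obtain a b c a' b' c' where pq: "p = (a, b, c)" "q = (a', b', c')"
        and *: "a \<in> A" "b \<in> B" "c \<in> C" "a' \<in> A" "b' \<in> B" "c' \<in> C" "f (a, b, c) = f (a', b', c')"
        by (cases p; cases q) auto
      then have "(a + b + c) + (a' + b' + c') = 0"
        using char2 by (simp add: f_def)
      then have "(a + a') + (b + b') + (c + c') = 0"
        by (simp only: add_ac)
      moreover have "a + a' \<in> A" "b + b' \<in> B" "c + c' \<in> C"
        using * planes by (auto simp: plane_def)
      ultimately have "a + a' = 0" "b + b' = 0" "c + c' = 0"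
        using ind unfolding independent3_def by blast+
      then show "p = q" using eqI by (simp add: pq)
    qed
    then have "card (f ` (A \<times> B \<times> C)) = card (UNIV :: 'a set)"
      by (simp add: card_image cardP card)
    then show "{a + b + c | a b c. a \<in> A \<and> b \<in> B \<and> c \<in> C} = UNIV"
      unfolding im using fin by (metis card_subset_eq subset_UNIV)
  next
    assume "{a + b + c | a b c. a \<in> A \<and> b \<in> B \<and> c \<in> C} = UNIV"
    then have "inj_on f (A \<times> B \<times> C)"
      unfolding im using finP by (intro eq_card_imp_inj_on) (simp_all only: cardP card)
    then show "independent3 A B C"
      using planes unfolding independent3_def plane_def
      by (auto simp: f_def dest!: inj_onD[where y = "(0, 0, 0)"])
  qed
qed

section \<open>Transfer to the concrete model\<close>

fun emb :: "f8 \<Rightarrow> gf8" where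
  "emb (F a b c) = (\<chi> i. if i = 0 then of_bool a else if i = 1 then of_bool b else of_bool c)"

text \<open>The index type counts modulo 3, so the value 3 in the case rule \<open>exhaust_3\<close>
  is the index 0.\<close>

lemma all_index3: "(\<forall>i :: 3. P i) \<longleftrightarrow> P 0 \<and> P 1 \<and> P 2"
proof -
  have "(3 :: 3) = 0" by simp
  then show ?thesis by (metis exhaust_3)
qed

lemma bij_emb: "bij emb"
proof (rule bijI)
  show "inj emb"
  proof (rule injI)
    fix x y assume "emb x = emb y"
    then have "emb x $ i = emb y $ i" for i by simp
    from this[of 0] this[of 1] this[of 2] show "x = y"
      by (cases x; cases y) (simp add: of_bool_eq_iff)
  qed
  show "surj emb"
  proof (rule surjI)
    fix v :: gf8
    show "emb (F (v $ 0 = 1) (v $ 1 = 1) (v $ 2 = 1)) = v"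
      by (simp add: vec_eq_iff all_index3)
  qed
qed

lemma of_bool_bit: "of_bool (a \<noteq> b) = (of_bool a + of_bool b :: bit)"
  "of_bool (a \<and> b) = (of_bool a * of_bool b :: bit)"
  by (cases a; cases b; simp)+

lemma emb_add: "emb (x + y) = emb x + emb y"
proof (cases x; cases y)
  fix a b c a' b' c' assume xy: "x = F a b c" "y = F a' b' c'"
  have "(\<chi> i. if i = 0 then p + p' else if i = 1 then q + q' else r + r') =
      (\<chi> i. if i = 0 then p else if i = 1 then q else r) +
      ((\<chi> i. if i = 0 then p' else if i = 1 then q' else r') :: gf8)" for p q r p' q' r'
    by (simp add: vec_eq_iff)
  then show ?thesis by (simp only: xy plus_f8.simps emb.simps of_bool_bit)
qed

lemma emb_mult: "emb (x * y) = gf8_mul (emb x) (emb y)"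
proof (cases x; cases y)
  fix a b c a' b' c' assume xy: "x = F a b c" "y = F a' b' c'"
  have "gf8_mul (\<chi> i. if i = 0 then p else if i = 1 then q else r)
      (\<chi> i. if i = 0 then p' else if i = 1 then q' else r') =
    (\<chi> i. if i = 0 then p * p' + (q * r' + r * q')
      else if i = 1 then p * q' + q * p' + (q * r' + r * q') + r * r'
      else p * r' + q * q' + r * p' + r * r')" for p q r p' q' r'
    by (simp add: gf8_mul_def Let_def cong: if_cong)
  then show ?thesis by (simp only: xy times_f8.simps emb.simps of_bool_bit)
qed

lemma emb_one: "emb 1 = gf8_one"
  by (simp add: one_f8_def gf8_one_def vec_eq_iff)

lemma emb_zero: "emb 0 = 0"
  by (simp add: zero_f8_def vec_eq_iff)

fun embW :: "W \<Rightarrow> V" where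
  "embW (x, y, z) = vec3 (emb x) (emb y) (emb z)"

lemma bij_embW: "bij embW"
proof (rule bijI)
  show "inj embW"
  proof (rule injI)
    fix p q assume "embW p = embW q"
    then have "embW p $ i = embW q $ i" for i by simp
    from this[of 0] this[of 1] this[of 2] show "p = q"
      by (cases p; cases q) (simp add: vec3_def bij_is_inj[OF bij_emb, THEN inj_eq])
  qed
  show "surj embW"
  proof (rule surjI)
    fix v :: V
    show "embW (inv emb (v $ 0), inv emb (v $ 1), inv emb (v $ 2)) = v"
      by (simp add: vec3_def vec_eq_iff[where 'a = gf8 and 'b = 3] all_index3 surj_f_inv_f[OF bij_is_surj[OF bij_emb]])
  qed
qed

lemma additive_embW: "additive embW"
  by standard (auto simp: vec3_def vec_eq_iff[where 'a = gf8 and 'b = 3] all_index3 emb_add)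

lemma W_add_self [simp]: "x + x = (0 :: W)"
  by (cases x) (simp add: zero_prod_def)

lemma card_W: "card (UNIV :: W set) = 512"
  by (simp add: card_f8 flip: UNIV_Times_UNIV)

lemma V_add_self: "x + x = (0 :: V)"
  by (simp add: vec_eq_iff)

lemma card_V: "card (UNIV :: V set) = 512"
  using bij_betw_same_card[OF bij_embW] card_W by simp

lemma pseudo_oval_iff_gen_pseudo_oval: "pseudo_oval Ov \<longleftrightarrow> gen_pseudo_oval Ov"
proof -
  have plane: "is_plane S \<longleftrightarrow> plane S" for S
    by (simp add: is_plane_def plane_def)
  have "spans_all3 A B C \<longleftrightarrow> independent3 A B C" if "plane A" "plane B" "plane C" for A B C
    using independent3_iff_spanning[OF V_add_self card_V that] by (simp add: spans_all3_def)
  then show ?thesis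
    unfolding pseudo_oval_def gen_pseudo_oval_def plane
    by (intro conj_cong ball_cong imp_cong refl) simp_all
qed

lemma proj_equiv_iff_lin_equiv: "proj_equiv O1 O2 \<longleftrightarrow> lin_equiv O1 O2"
  by (simp add: proj_equiv_def lin_equiv_def additive_def)

text \<open>For nonzero \<open>p\<close> this is a one-dimensional GF(8)-subspace: a point of
  PG(2,8), and over GF(2) a plane of PG(8,2).\<close>

definition line :: "W \<Rightarrow> W set" where
  "line p = range (\<lambda>l. smul l p)"

lemma gf8_all_emb: "{f t | t. True} = range (\<lambda>t. f (emb t))"
proof -
  have "range (\<lambda>t. f (emb t)) = f ` range emb" by (simp only: image_image)
  then show ?thesis by (simp add: bij_is_surj[OF bij_emb] full_SetCompr_eq)
qed

lemma pt_plane_embW: "pt_plane (embW p) = embW ` line p"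
proof -
  obtain x y z where p: "p = (x, y, z)" by (cases p)
  have "(\<chi> i. gf8_mul (emb l) (embW p $ i)) = embW (smul l p)" for l
    by (simp add: p vec3_def vec_eq_iff[where 'a = gf8 and 'b = 3] all_index3 emb_mult)
  then show ?thesis
    unfolding pt_plane_def gf8_all_emb by (simp add: line_def image_image)
qed

lemma conic_embW: "conic = embW ` set conic_points"
  unfolding conic_def gf8_all_emb
  by (simp add: conic_points_def gf8_sqrt_def gf8_sq_def emb_mult emb_one emb_zero
      enum_UNIV image_image)

lemma pointed_conic_embW: "pointed_conic = embW ` set pointed_conic_points"
  unfolding pointed_conic_def gf8_all_emb
  by (simp add: pointed_conic_points_def gf8_sq_def emb_mult emb_one emb_zero
      enum_UNIV image_image)

lemma lin_equiv_elementary: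
  assumes "K = embW ` set L"
  shows "lin_equiv (line ` set L) (elementary K)"
  unfolding lin_equiv_def
  using bij_embW additive_embW
  by (intro exI[of _ embW]) (simp add: assms elementary_def image_image pt_plane_embW)

section \<open>Linear maps and lines\<close>

lemma f8_add_left_self [simp]: "x + (x + y) = (y :: f8)"
  by (simp flip: add.assoc)

lemma smul_add: "smul l (p + q) = smul l p + smul l q"
  by (cases p; cases q) (simp add: algebra_simps)

lemma smul_add_left: "smul (l + m) p = smul l p + smul m p"
  by (cases p) (simp add: algebra_simps)

lemma smul_smul: "smul l (smul m p) = smul (l * m) p"
  by (cases p) (simp add: algebra_simps)

lemma smul_0 [simp]: "smul 0 p = 0" "smul l 0 = 0"
  by (cases p; simp add: zero_prod_def)+

lemma smul_1 [simp]: "smul 1 p = p"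
  by (cases p) simp

lemma smul_eq_0_iff: "smul l p = 0 \<longleftrightarrow> l = 0 \<or> p = 0"
  by (cases p) (auto simp: zero_prod_def)

lemma additive_lin: "additive (lin M)"
proof
  fix x y show "lin M (x + y) = lin M x + lin M y"
    by (cases M rule: prod_cases3; cases x; cases y) (simp add: smul_add_left add_ac)
qed

lemma lin_smul: "lin M (smul l x) = smul l (lin M x)"
  by (cases M rule: prod_cases3; cases x) (simp add: smul_add smul_smul)

lemmas f8_ring_simps = distrib_left distrib_right mult_ac add_ac add_0_left add_0_right
  f8_add_self f8_add_left_self

text \<open>Cramer's rule: each coefficient times the determinant is a combination of the
  coordinates \<open>X\<close>, \<open>Y\<close>, \<open>Z\<close> of the vanishing sum, weighted by
  cofactors.\<close>

lemma det_independent: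
  assumes "det p q r \<noteq> 0" "smul a p + smul b q + smul c r = 0"
  shows "a = 0" "b = 0" "c = 0"
proof -
  obtain x1 y1 z1 x2 y2 z2 x3 y3 z3
    where pqr: "p = (x1, y1, z1)" "q = (x2, y2, z2)" "r = (x3, y3, z3)"
    by (cases p; cases q; cases r)
  define X Y Z where "X = a * x1 + b * x2 + c * x3" "Y = a * y1 + b * y2 + c * y3"
    "Z = a * z1 + b * z2 + c * z3"
  have 0: "X = 0" "Y = 0" "Z = 0"
    using assms(2) by (simp_all add: pqr X_Y_Z_def zero_prod_def)
  have "a * det p q r = (y2 * z3 + z2 * y3) * X + (x2 * z3 + z2 * x3) * Y + (x2 * y3 + y2 * x3) * Z"
    by (simp only: pqr det.simps X_Y_Z_def f8_ring_simps)
  moreover have "b * det p q r =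
      (y1 * z3 + z1 * y3) * X + (x1 * z3 + z1 * x3) * Y + (x1 * y3 + y1 * x3) * Z"
    by (simp only: pqr det.simps X_Y_Z_def f8_ring_simps)
  moreover have "c * det p q r =
      (y1 * z2 + z1 * y2) * X + (x1 * z2 + z1 * x2) * Y + (x1 * y2 + y1 * x2) * Z"
    by (simp only: pqr det.simps X_Y_Z_def f8_ring_simps)
  ultimately show "a = 0" "b = 0" "c = 0" using assms(1) by (simp_all add: 0)
qed

lemma bij_lin:
  assumes "det p q r \<noteq> 0"
  shows "bij (lin (p, q, r))"
proof -
  interpret additive "lin (p, q, r)" by (rule additive_lin)
  have "inj (lin (p, q, r))"
  proof (rule injI)
    fix x y assume "lin (p, q, r) x = lin (p, q, r) y"
    then have "lin (p, q, r) (x - y) = 0" by (simp only: diff diff_self)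
    moreover obtain a b c where abc: "x - y = (a, b, c)" by (cases "x - y")
    ultimately have "smul a p + smul b q + smul c r = 0" by (simp only: lin.simps)
    then have "a = 0" "b = 0" "c = 0" using det_independent[OF assms] by blast+
    then have "x - y = 0" by (simp only: abc zero_prod_def)
    then show "x = y" by (simp only: right_minus_eq)
  qed
  then show ?thesis by (simp add: bij_def finite_UNIV_inj_surj)
qed

lemma line_smul: "l \<noteq> 0 \<Longrightarrow> line (smul l p) = line p"
  unfolding line_def
proof (intro set_eqI iffI; elim rangeE)
  fix x m assume "x = smul m (smul l p)"
  then show "x \<in> range (\<lambda>l. smul l p)" by (simp add: smul_smul)
next
  fix x m assume "l \<noteq> 0" "x = smul m p"
  then have "x = smul (m / l) (smul l p)" by (simp add: smul_smul)
  then show "x \<in> range (\<lambda>m. smul m (smul l p))" by blast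
qed

lemma lin_line: "lin M ` line p = line (lin M p)"
  by (simp add: line_def image_image lin_smul)

lemma point_in_line: "p \<in> line p"
  unfolding line_def by (rule range_eqI[of _ _ 1]) simp

lemma plane_line: "p \<noteq> 0 \<Longrightarrow> plane (line p)"
proof -
  assume "p \<noteq> 0"
  have "inj (\<lambda>l. smul l p)"
  proof (rule injI)
    fix l m assume "smul l p = smul m p"
    then have "smul (l + m) p = 0" by (simp add: smul_add_left)
    then show "l = m" using \<open>p \<noteq> 0\<close> by (simp add: smul_eq_0_iff f8_add_eq_0_iff)
  qed
  then have "card (line p) = 8" by (simp add: line_def card_image card_f8)
  moreover have "0 \<in> line p" unfolding line_def by (rule range_eqI[of _ _ 0]) simp
  moreover have "x + y \<in> line p" if xy: "x \<in> line p" "y \<in> line p" for x y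
  proof -
    obtain l m where "x = smul l p" "y = smul m p" using xy unfolding line_def by blast
    then have "x + y = smul (l + m) p" by (simp add: smul_add_left)
    then show ?thesis unfolding line_def by blast
  qed
  ultimately show ?thesis by (simp add: plane_def)
qed

lemma independent3_line:
  assumes "det p q r \<noteq> 0"
  shows "independent3 (line p) (line q) (line r)"
  using det_independent[OF assms] by (fastforce simp: independent3_def line_def)

lemma normalize_point:
  assumes "p \<noteq> 0"
  obtains l where "l \<noteq> 0" "p = smul l (normalize_point p)"
proof -
  obtain x y z where p: "p = (x, y, z)" by (cases p)
  have "\<exists>l. l \<noteq> 0 \<and> p = smul l (normalize_point p)"
    using assms
    by (intro exI[of _ "if x \<noteq> 0 then x else if y \<noteq> 0 then y else z"]) (simp add: p zero_prod_def)
  then show ?thesis using that by blast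
qed

text \<open>\<open>carries\<close> only yields an inclusion. A bijection is injective on sets of
  planes, so the equal cardinalities turn the inclusion into an equality.\<close>

lemma carries_image:
  assumes "carries M K L" "0 \<notin> set K" "card (line ` set K) = card (line ` set L)"
  shows "bij (lin M)" "image (lin M) ` line ` set K = line ` set L"
proof -
  obtain p q r where M: "M = (p, q, r)" by (cases M)
  from assms(1) show bij: "bij (lin M)" by (auto simp: M intro: bij_lin split: if_splits)
  have "lin M ` line x \<in> line ` set L" if "x \<in> set K" for x
  proof -
    interpret additive "lin M" by (rule additive_lin)
    have "lin M x \<noteq> 0" using that assms(2) bij_is_inj[OF bij] zero by (metis injD)
    then obtain l where "l \<noteq> 0" "lin M x = smul l (normalize_point (lin M x))"
      by (rule normalize_point)
    then have "lin M ` line x = line (normalize_point (lin M x))"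
      by (metis lin_line line_smul)
    moreover have "normalize_point (lin M x) \<in> set L"
      using assms(1) that
      by (auto simp: M find_None_iff split: if_splits simp del: split_paired_All split_paired_Ex lin.simps)
    ultimately show ?thesis by simp
  qed
  then have "image (lin M) ` line ` set K \<subseteq> line ` set L" by auto
  moreover have "inj (image (lin M))" using bij_is_inj[OF bij] by (simp add: inj_image_eq_iff inj_def)
  then have "card (image (lin M) ` line ` set K) = card (line ` set L)"
    using assms(3) by (simp add: card_image inj_on_subset)
  ultimately show "image (lin M) ` line ` set K = line ` set L"
    by (intro card_subset_eq) simp_all
qed

text \<open>If the two planes coincide, then p + p + 0 = 0 is a relation between the three planes.
  Independence forces \<open>p = 0\<close>, and the determinant vanishes.\<close>

lemma line_neq_if_det:
  assumes "det p q r \<noteq> 0"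
  shows "line p \<noteq> line q"
proof
  assume "line p = line q"
  then have "p = 0 \<and> p = 0 \<and> (0 :: W) = 0"
    using independent3_line[OF assms] point_in_line[of p] plane_line[of r] W_add_self[of p]
    unfolding independent3_def line_def by (metis add.right_neutral rangeI smul_0(1))
  then show False using assms by (cases q; cases r) (simp add: zero_prod_def)
qed

lemma gen_pseudo_oval_lines:
  assumes card: "card K = 9"
    and arc: "\<forall>p \<in> K. \<forall>q \<in> K. \<forall>r \<in> K. p \<noteq> q \<and> p \<noteq> r \<and> q \<noteq> r \<longrightarrow> det p q r \<noteq> 0"
  shows "gen_pseudo_oval (line ` K)" "0 \<notin> K"
proof -
  \<comment> \<open>The arc condition speaks of triples only, so statements about one or two points
    have to borrow further points of \<open>K\<close>.\<close>
  have third: "\<exists>r \<in> K. r \<noteq> p \<and> r \<noteq> q" for p q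
  proof (rule ccontr)
    assume "\<not> ?thesis"
    then have "K \<subseteq> {p, q}" by blast
    then have "card K \<le> card {p, q}" by (intro card_mono) simp_all
    also have "\<dots> \<le> 2" by (simp add: card_insert_if)
    finally show False using card by simp
  qed
  have "p \<noteq> 0" if "p \<in> K" for p
  proof -
    obtain q where q: "q \<in> K" "q \<noteq> p" using third by blast
    obtain r where r: "r \<in> K" "r \<noteq> p" "r \<noteq> q" using third by blast
    have "det p q r \<noteq> 0" using q r that by (intro arc[rule_format]) auto
    then show ?thesis by (cases q; cases r) (auto simp: zero_prod_def)
  qed
  then show "0 \<notin> K" by blast
  have "inj_on line K"
  proof (rule inj_onI, rule ccontr)
    fix p q assume pq: "p \<in> K" "q \<in> K" "line p = line q" "p \<noteq> q"
    obtain r where r: "r \<in> K" "r \<noteq> p" "r \<noteq> q" using third by blast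
    have "det p q r \<noteq> 0" using pq r by (intro arc[rule_format]) auto
    then show False using line_neq_if_det pq(3) by blast
  qed
  then have "card (line ` K) = 9" by (simp add: card_image card)
  moreover have "independent3 (line p) (line q) (line r)"
    if "p \<in> K" "q \<in> K" "r \<in> K" "line p \<noteq> line q" "line p \<noteq> line r" "line q \<noteq> line r" for p q r
  proof (rule independent3_line)
    show "det p q r \<noteq> 0" using that by (intro arc[rule_format]) auto
  qed
  ultimately show "gen_pseudo_oval (line ` K)"
    unfolding gen_pseudo_oval_def using \<open>\<And>p. p \<in> K \<Longrightarrow> p \<noteq> 0\<close> plane_line by (simp add: ball_simps)
qed

lemma distinct_conic_points: "distinct conic_points" "length conic_points = 9"
  by code_simp+

lemma distinct_pointed_conic_points: "distinct pointed_conic_points" "length pointed_conic_points = 9"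
  by code_simp+

lemmas gen_pseudo_oval_conic = gen_pseudo_oval_lines[OF _ conic_points_arc,
    unfolded distinct_card[OF distinct_conic_points(1)], OF distinct_conic_points(2)]

lemmas gen_pseudo_oval_pointed_conic = gen_pseudo_oval_lines[OF _ pointed_conic_points_arc,
    unfolded distinct_card[OF distinct_pointed_conic_points(1)], OF distinct_pointed_conic_points(2)]

section \<open>From the search to the ovals through a frame\<close>

definition slope_arc :: "f8 set \<Rightarrow> (f8 \<Rightarrow> f8) \<Rightarrow> bool" where
  "slope_arc A f \<longleftrightarrow> (\<forall>t \<in> A. f t \<noteq> 0 \<and> (\<forall>t' \<in> A. t \<noteq> t' \<longrightarrow> f t \<noteq> f t' \<and> t' * f t \<noteq> t * f t' \<and>
     (\<forall>t'' \<in> A. t \<noteq> t'' \<and> t' \<noteq> t'' \<longrightarrow> (t'' + t') * f t + (t'' + t) * f t' + (t' + t) * f t'' \<noteq> 0)))"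

lemma extends_arc_iff:
  "extends_arc pts t y \<longleftrightarrow> y \<noteq> 0 \<and> (\<forall>(t', y') \<in> set pts. y \<noteq> y' \<and> t' * y \<noteq> t * y' \<and>
     (\<forall>(t'', y'') \<in> set pts. t' \<noteq> t'' \<longrightarrow>
        (t'' + t') * y + (t'' + t) * y' + (t' + t) * y'' \<noteq> 0))"
  by (cases y) (simp only: extends_arc.simps Let_def)

text \<open>An arc given by \<open>f\<close> picks the branch \<open>y = f t\<close> at every slope
  \<open>t\<close>. This branch passes \<open>extends_arc\<close> because all points chosen so far
  lie on the same arc, so following it leads to a leaf where \<open>P\<close> has been
  checked.\<close>

lemma search_sound:
  assumes "search P pts ts" "distinct (ts @ map fst pts)"
    "set pts \<subseteq> (\<lambda>t. (t, f t)) ` A" "set ts \<subseteq> A" "slope_arc A f"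
  shows "\<exists>pts'. P pts' \<and> set pts' = set pts \<union> (\<lambda>t. (t, f t)) ` set ts"
  using assms
proof (induction ts arbitrary: pts)
  case Nil
  then show ?case by auto
next
  case (Cons t ts)
  have *: "t' \<in> A \<and> y' = f t' \<and> t \<noteq> t'" if "(t', y') \<in> set pts" for t' y'
    using that Cons.prems(2,3) by (force simp: image_iff)
  have "t \<in> A" using Cons.prems(4) by simp
  have arc: "f t \<noteq> f t' \<and> t' * f t \<noteq> t * f t' \<and>
      (\<forall>t'' \<in> A. t \<noteq> t'' \<and> t' \<noteq> t'' \<longrightarrow> (t'' + t') * f t + (t'' + t) * f t' + (t' + t) * f t'' \<noteq> 0)"
    if "t' \<in> A" "t \<noteq> t'" for t'
    using Cons.prems(5)[unfolded slope_arc_def, rule_format, OF \<open>t \<in> A\<close>] that by blast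
  have "extends_arc pts t (f t)"
    unfolding extends_arc_iff
  proof (intro conjI ballI)
    show "f t \<noteq> 0" using Cons.prems(5) \<open>t \<in> A\<close> by (simp add: slope_arc_def)
    fix p assume "p \<in> set pts"
    moreover obtain t' y' where p: "p = (t', y')" by (cases p)
    ultimately have t': "t' \<in> A" "y' = f t'" "t \<noteq> t'" using * by blast+
    have "(t'' + t') * f t + (t'' + t) * y' + (t' + t) * y'' \<noteq> 0"
      if "(t'', y'') \<in> set pts" "t' \<noteq> t''" for t'' y''
      using arc[OF t'(1,3)] *[OF that(1)] that(2) t'(2) by blast
    then show "case p of (t', y') \<Rightarrow> f t \<noteq> y' \<and> t' * f t \<noteq> t * y' \<and>
      (\<forall>(t'', y'') \<in> set pts. t' \<noteq> t'' \<longrightarrow>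
         (t'' + t') * f t + (t'' + t) * y' + (t' + t) * y'' \<noteq> 0)"
      using arc[OF t'(1,3)] t'(2) unfolding p prod.case by blast
  qed
  then have "search P ((t, f t) # pts) ts"
    using Cons.prems(1) by (metis search.simps(2))
  then obtain pts' where "P pts'" "set pts' = set ((t, f t) # pts) \<union> (\<lambda>t. (t, f t)) ` set ts"
    using Cons.IH[of "(t, f t) # pts"] Cons.prems(2-5) by auto
  then show ?case by (intro exI[of _ pts']) auto
qed

lemma all_ovals_classified: "m \<noteq> 0 \<Longrightarrow> m \<noteq> 1 \<Longrightarrow> all_ovals_classified m"
proof (cases m)
  case (F a b c)
  assume "m \<noteq> 0" "m \<noteq> 1"
  then show ?thesis
    using oval_classification
    by (cases a; cases b; cases c) (simp_all add: F zero_f8_def one_f8_def)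
qed

lemma is_conic_or_pointedD:
  assumes "is_conic_or_pointed m pts"
  shows "\<exists>M. carries M conic_points (oval_points pts) \<or> carries M pointed_conic_points (oval_points pts)"
proof (rule ccontr)
  assume no: "\<not> ?thesis"
  define K where "K = oval_points pts"
  define Q :: W where "Q = (1, m, sum_list (map snd pts))"
  have "find (\<lambda>N. case remove1 N K of
       p # r # _ \<Rightarrow> carries (frame_matrix p N Q r) pointed_conic_points K) K \<noteq> None"
    using assms no unfolding is_conic_or_pointed_def Let_def K_def Q_def by metis
  then obtain N where N: "N \<in> set K" "case remove1 N K of
       p # r # _ \<Rightarrow> carries (frame_matrix p N Q r) pointed_conic_points K"
    by (auto simp: find_None_iff)
  have "length K \<ge> 3" by (simp add: K_def oval_points_def)
  then have "length (remove1 N K) \<ge> 2" using N(1) by (simp add: length_remove1)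
  then obtain p r ps where "remove1 N K = p # r # ps"
    by (metis Suc_le_length_iff numeral_2_eq_2)
  then have "carries (frame_matrix p N Q r) pointed_conic_points K" using N(2) by simp
  then show False using no unfolding K_def by blast
qed

text \<open>Here \<open>m\<close> is the one nonzero slope that the oval misses. The unit point (1,
  1, 1) accounts for \<open>f 1 = 1\<close> and for the start \<open>[(1, 1)]\<close> of the search.
  The matrix found maps a standard oval to \<open>K\<close>, hence the final use of
  symmetry.\<close>

lemma oval_lin_equiv:
  fixes f :: "f8 \<Rightarrow> f8" and m :: f8
  defines "A \<equiv> {t. t \<noteq> 0 \<and> t \<noteq> m}"
  defines "K \<equiv> {(1, 0, 0), (0, 1, 0), (0, 0, 1)} \<union> (\<lambda>t. (1, t, f t)) ` A"
  assumes "m \<noteq> 0" "m \<noteq> 1" "f 1 = 1" "slope_arc A f" "card (line ` K) = 9"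
  shows "lin_equiv (line ` K) (line ` set conic_points) \<or>
    lin_equiv (line ` K) (line ` set pointed_conic_points)"
proof -
  have A: "A = insert 1 (set (remove1 m slopes))"
    using \<open>m \<noteq> 0\<close> \<open>m \<noteq> 1\<close> by (auto simp: A_def slopes_def set_remove1_eq enum_UNIV enum_distinct)
  have s1: "search (is_conic_or_pointed m) [(1, 1)] (remove1 m slopes)"
    using all_ovals_classified[OF \<open>m \<noteq> 0\<close> \<open>m \<noteq> 1\<close>] by (simp add: all_ovals_classified_def)
  have s2: "distinct (remove1 m slopes @ map fst [(1, 1)])"
    using set_remove1_subset[of m slopes] by (auto simp: slopes_def enum_distinct distinct_remove1)
  have s3: "set [(1, 1)] \<subseteq> (\<lambda>t. (t, f t)) ` A" "set (remove1 m slopes) \<subseteq> A"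
    using assms(5) by (auto simp: A)
  obtain pts where pts: "is_conic_or_pointed m pts"
    "set pts = set [(1, 1)] \<union> (\<lambda>t. (t, f t)) ` set (remove1 m slopes)"
    using search_sound[OF s1 s2 s3 assms(6)] by (elim exE conjE)
  have K: "set (oval_points pts) = K"
    by (auto simp: oval_points_def K_def A pts(2) assms(5) image_image)
  obtain M where "carries M conic_points (oval_points pts) \<or> carries M pointed_conic_points (oval_points pts)"
    using is_conic_or_pointedD[OF pts(1)] by blast
  then have "lin_equiv (line ` set conic_points) (line ` K) \<or>
    lin_equiv (line ` set pointed_conic_points) (line ` K)"
    using carries_image[of M conic_points "oval_points pts"] gen_pseudo_oval_conic
      carries_image[of M pointed_conic_points "oval_points pts"] gen_pseudo_oval_pointed_conic
      additive_lin[of M] assms(7)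
    unfolding lin_equiv_def K gen_pseudo_oval_def by metis
  then show ?thesis using lin_equiv_sym by blast
qed

section \<open>Coordinates\<close>

lemma additive_amap: "additive (amap p)"
proof
  fix x y
  obtain u v w where p: "p = (u, v, w)" by (cases p)
  obtain a b c a' b' c' where xy: "x = F a b c" "y = F a' b' c'" by (cases x; cases y)
  show "amap p (x + y) = amap p x + amap p y"
    unfolding p xy plus_f8.simps amap.simps
    by (cases a; cases b; cases c; cases a'; cases b'; cases c'; simp add: add_ac)
qed

lemma additive_eq_amap:
  assumes "additive A"
  shows "A = amap (A 1, A alpha, A (alpha * alpha))"
proof
  interpret additive A by fact
  fix x
  obtain a b c where x: "x = F a b c" by (cases x)
  have "x = (if a then 1 else 0) + (if b then alpha else 0) + (if c then alpha * alpha else 0)"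
    unfolding x by (cases a; cases b; cases c) (simp_all add: one_f8_def zero_f8_def)
  then have "A x = A (if a then 1 else 0) + A (if b then alpha else 0) + A (if c then alpha * alpha else 0)"
    by (simp only: add)
  then show "A x = amap (A 1, A alpha, A (alpha * alpha)) x"
    unfolding x amap.simps by (simp only: if_distrib[of A] zero)
qed

section \<open>Using the searches among additive maps\<close>

lemma amap_in_candidates:
  assumes "disagree (amap p) (\<lambda>x. 0)" "disagree (amap p) (\<lambda>x. x)" "disagree (amap p) (\<lambda>x. s * x)"
  shows "p \<in> set (candidates s)"
proof -
  obtain u v w where p: "p = (u, v, w)" by (cases p)
  obtain a b c where s: "s = F a b c" by (cases s)
  have vals: "amap p x \<in> set (candidate_values s x)" if "x \<noteq> 0" for x
    using that assms unfolding s by (simp add: disagree_def enum_UNIV)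
  have "amap p 1 = u" "amap p alpha = v" "amap p (alpha * alpha) = w"
    by (simp_all add: p one_f8_def)
  then have "u \<in> set (candidate_values s 1)" "v \<in> set (candidate_values s alpha)"
    "w \<in> set (candidate_values s (alpha * alpha))"
    using vals[of 1] vals[of alpha] vals[of "alpha * alpha"]
    by (simp_all add: zero_f8_def one_f8_def)
  then show ?thesis
    using assms unfolding p s candidates.simps
    by (simp del: candidate_values.simps amap.simps times_f8.simps)
qed

lemma scalar_if_disagree:
  assumes "s = alpha \<or> s = alpha + 1" "additive A" "additive B"
    and A: "disagree A (\<lambda>x. 0)" "disagree A (\<lambda>x. x)" "disagree A (\<lambda>x. s * x)"
    and B: "disagree B (\<lambda>x. 0)" "disagree B (\<lambda>x. x)" "disagree B (\<lambda>x. s * x)"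
    and AB: "disagree A B"
  shows "\<exists>t. A = (\<lambda>x. t * x)"
proof -
  obtain p where p: "A = amap p" using additive_eq_amap[OF assms(2)] by blast
  obtain q where q: "B = amap q" using additive_eq_amap[OF assms(3)] by blast
  have "p \<in> set (candidates s)" "q \<in> set (candidates s)"
    using A B unfolding p q by (auto intro: amap_in_candidates)
  then have "scalar p"
    using candidates_scalar_if_disagree assms(1) AB unfolding p q list_all_iff Let_def
    by (metis list.set_intros)
  then show ?thesis unfolding scalar_def p by blast
qed

text \<open>The pairs of \<open>s\<close> and \<open>B\<close>, \<open>t\<close> and
  \<open>C\<close>, \<open>u\<close> and \<open>D\<close> form a triangle of compatible pairs, which
  \<open>candidates_scalar_if_compatible\<close> excludes unless \<open>B\<close> is a
  multiplication.\<close>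

lemma scalar_if_compatible:
  assumes slopes: "s \<noteq> 0" "s \<noteq> 1" "t \<noteq> 0" "t \<noteq> 1" "u \<noteq> 0" "u \<noteq> 1"
    and distinct: "s \<noteq> t" "s \<noteq> u" "t \<noteq> u"
    and additive: "additive B" "additive C" "additive D"
    and B: "disagree B (\<lambda>x. 0)" "disagree B (\<lambda>x. x)" "disagree B (\<lambda>x. s * x)"
    and C: "disagree C (\<lambda>x. 0)" "disagree C (\<lambda>x. x)" "disagree C (\<lambda>x. t * x)"
    and D: "disagree D (\<lambda>x. 0)" "disagree D (\<lambda>x. x)" "disagree D (\<lambda>x. u * x)"
    and BC: "disagree B C" "disagree (\<lambda>z. B (t * z)) (\<lambda>z. C (s * z))"
    and BD: "disagree B D" "disagree (\<lambda>z. B (u * z)) (\<lambda>z. D (s * z))"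
    and CD: "disagree C D" "disagree (\<lambda>z. C (u * z)) (\<lambda>z. D (t * z))"
  shows "\<exists>y. B = (\<lambda>x. y * x)"
proof -
  obtain p where p: "B = amap p" using additive_eq_amap[OF additive(1)] by blast
  obtain q where q: "C = amap q" using additive_eq_amap[OF additive(2)] by blast
  obtain r where r: "D = amap r" using additive_eq_amap[OF additive(3)] by blast
  define T where "T = [(t, q). t \<leftarrow> slopes, q \<leftarrow> candidates t]"
  have "p \<in> set (candidates s)" "q \<in> set (candidates t)" "r \<in> set (candidates u)"
    using B C D unfolding p q r by (auto intro: amap_in_candidates)
  moreover have "s \<in> set slopes" "t \<in> set slopes" "u \<in> set slopes"
    using slopes by (simp_all add: slopes_def enum_UNIV)
  ultimately have T: "(s, p) \<in> set T" "(t, q) \<in> set T" "(u, r) \<in> set T"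
    by (auto simp: T_def)
  define R where "R = filter (\<lambda>(t, q). if t = s then False else compatible (s, p) (t, q)) T"
  have c: "compatible (s, p) (t, q)" "compatible (s, p) (u, r)" "compatible (t, q) (u, r)"
    using BC BD CD by (simp_all add: p q r)
  then have R: "(t, q) \<in> set R" "(u, r) \<in> set R"
    using T distinct by (auto simp: R_def simp del: compatible.simps)
  have "\<not> list_all (\<lambda>(t, q). list_all (\<lambda>(u, r). t = u \<or> \<not> compatible (t, q) (u, r)) R) R"
  proof
    assume "list_all (\<lambda>(t, q). list_all (\<lambda>(u, r). t = u \<or> \<not> compatible (t, q) (u, r)) R) R"
    from bspec[OF this[unfolded list_all_iff] R(1)]
    have "\<forall>x \<in> set R. case x of (u, r) \<Rightarrow> t = u \<or> \<not> compatible (t, q) (u, r)"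
      by (simp only: prod.case)
    from bspec[OF this R(2)] show False
      using c(3) \<open>t \<noteq> u\<close> by (simp only: prod.case simp_thms)
  qed
  moreover have "if scalar p then True else
      list_all (\<lambda>(t, q). list_all (\<lambda>(u, r). t = u \<or> \<not> compatible (t, q) (u, r)) R) R"
    using bspec[OF candidates_scalar_if_compatible[unfolded Let_def list_all_iff[of _ "concat _"],
          folded T_def] T(1)]
    unfolding R_def by (simp only: prod.case)
  ultimately have "scalar p" by (metis (full_types))
  then show ?thesis unfolding scalar_def p by blast
qed

section \<open>Moving four members to the standard frame\<close>

lemma W_add_eq_0_iff: "x + y = 0 \<longleftrightarrow> x = (y :: W)"
  by (cases x; cases y) (simp add: zero_prod_def f8_add_eq_0_iff)

lemma W_add_left_self: "x + (x + y) = (y :: W)"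
  by (simp flip: add.assoc)

lemma additive_injI:
  fixes g :: "'a::ab_group_add \<Rightarrow> 'b::ab_group_add"
  assumes "additive g" "\<And>x. g x = 0 \<Longrightarrow> x = 0"
  shows "inj g"
proof (rule injI)
  interpret additive g by fact
  fix x y assume "g x = g y"
  then have "g (x - y) = 0" by (simp only: diff diff_self)
  then show "x = y" using assms(2) right_minus_eq by blast
qed

lemma plane_eqI: "plane A \<Longrightarrow> plane B \<Longrightarrow> A \<subseteq> B \<Longrightarrow> A = B"
  unfolding plane_def by (metis card.infinite card_subset_eq zero_neq_numeral)

lemma plane_range:
  fixes f :: "f8 \<Rightarrow> 'a::ab_group_add"
  assumes "additive f" "inj f"
  shows "plane (range f)"
  unfolding plane_def using assms
  by (auto simp: card_image card_f8 simp flip: additive.add) (metis additive.zero rangeI)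

text \<open>A basis is chosen greedily, each vector outside the span of the previous ones; these
  spans have at most four of the eight elements.\<close>

lemma plane_parametrization:
  fixes S :: "W set"
  assumes "plane S"
  obtains f :: "f8 \<Rightarrow> W" where "additive f" "inj f" "range f = S"
proof -
  have S: "0 \<in> S" "card S = 8" and cl: "\<And>x y. x \<in> S \<Longrightarrow> y \<in> S \<Longrightarrow> x + y \<in> S"
    using assms by (auto simp: plane_def)
  have ex: "\<exists>x. x \<in> S \<and> x \<notin> set xs" if "length xs < 8" for xs :: "W list"
  proof (rule ccontr)
    assume "\<not> ?thesis"
    then have "S \<subseteq> set xs" by blast
    then have "card S \<le> card (set xs)" by (intro card_mono) simp_all
    also have "\<dots> \<le> length xs" by (rule card_length)
    finally show False using that S(2) by simp
  qed
  obtain u where u: "u \<in> S" "u \<notin> set [0]" using ex[of "[0]"] by force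
  obtain v where v: "v \<in> S" "v \<notin> set [0, u]" using ex[of "[0, u]"] by force
  obtain w where w: "w \<in> S" "w \<notin> set [0, u, v, u + v]" using ex[of "[0, u, v, u + v]"] by force
  define f where "f = (\<lambda>x. case x of F a b c \<Rightarrow>
    (if a then u else 0) + (if b then v else 0) + (if c then w else 0))"
  have add: "additive f"
  proof
    fix x y
    obtain a b c a' b' c' where xy: "x = F a b c" "y = F a' b' c'" by (cases x; cases y)
    show "f (x + y) = f x + f y"
      unfolding xy plus_f8.simps f_def f8.case
      by (cases a; cases b; cases c; cases a'; cases b'; cases c';
          simp only: if_True if_False simp_thms add_ac W_add_self W_add_left_self add_0_left add_0_right)
  qed
  moreover have "inj f"
  proof (rule additive_injI[OF add])
    fix x assume fx: "f x = 0"
    obtain a b c where x: "x = F a b c" by (cases x)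
    have "\<not> a \<and> \<not> b \<and> \<not> c"
      using fx u(2) v(2) w(2) W_add_eq_0_iff[of u v] W_add_eq_0_iff[of u w] W_add_eq_0_iff[of v w]
        W_add_eq_0_iff[of "u + v" w]
      unfolding x f_def f8.case by (cases a; cases b; cases c) auto
    then show "x = 0" by (simp add: x zero_f8_def)
  qed
  moreover have "range f = S"
  proof (rule plane_eqI[OF plane_range assms])
    show "additive f" "inj f" by fact+
    show "range f \<subseteq> S"
    proof (rule image_subsetI)
      fix x show "f x \<in> S"
        using S(1) u(1) v(1) w(1) cl by (cases x) (auto simp: f_def)
    qed
  qed
  ultimately show ?thesis using that by blast
qed

lemma independent3_unique:
  fixes A B C :: "W set"
  assumes "independent3 A B C" "plane A" "plane B" "plane C"
    and "a \<in> A" "b \<in> B" "c \<in> C" "a' \<in> A" "b' \<in> B" "c' \<in> C" "a + b + c = a' + b' + c'"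
  shows "a = a'" "b = b'" "c = c'"
proof -
  have "a + a' \<in> A" "b + b' \<in> B" "c + c' \<in> C"
    using assms by (auto simp: plane_def)
  moreover have "(a + b + c) + (a' + b' + c') = 0" by (simp only: assms(11) W_add_self)
  then have "(a + a') + (b + b') + (c + c') = 0" by (simp only: add_ac)
  ultimately have "a + a' = 0" "b + b' = 0" "c + c' = 0"
    using assms(1) unfolding independent3_def by blast+
  then show "a = a'" "b = b'" "c = c'" by (simp_all only: W_add_eq_0_iff)
qed

definition framed :: "W set set \<Rightarrow> bool" where
  "framed Ov \<longleftrightarrow> {line (1, 0, 0), line (0, 1, 0), line (0, 0, 1), line (1, 1, 1)} \<subseteq> Ov"

text \<open>Four members \<open>P\<close>, \<open>Q\<close>, \<open>R\<close>, \<open>U\<close> are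
  picked. Splitting a parametrization \<open>f\<close> of \<open>U\<close> along
  \<open>P + Q + R\<close> gives additive maps \<open>p\<close>, \<open>q\<close>, \<open>r\<close>
  into the three summands. The map \<open>h\<close> built from them takes the standard frame to
  \<open>P\<close>, \<open>Q\<close>, \<open>R\<close>, \<open>U\<close>, and its inverse does what
  is needed.\<close>

lemma gen_pseudo_oval_framed:
  fixes Ov :: "W set set"
  assumes "gen_pseudo_oval Ov"
  shows "\<exists>Ov'. lin_equiv Ov Ov' \<and> framed Ov'"
proof -
  have planes: "\<And>S. S \<in> Ov \<Longrightarrow> plane S" and card: "card Ov = 9"
    and ind: "\<And>A B C. A \<in> Ov \<Longrightarrow> B \<in> Ov \<Longrightarrow> C \<in> Ov \<Longrightarrow> A \<noteq> B \<Longrightarrow> A \<noteq> C \<Longrightarrow> B \<noteq> C \<Longrightarrow> independent3 A B C"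
    using assms by (auto simp: gen_pseudo_oval_def)
  obtain xs where xs: "set xs = Ov" "distinct xs"
    using card finite_distinct_list[of Ov] by (metis card.infinite zero_neq_numeral)
  have "length xs = 9" using xs card distinct_card by metis
  then obtain P Q R U ys where "xs = P # Q # R # U # ys"
    by (auto simp: length_Suc_conv numeral_eq_Suc)
  then have mem: "P \<in> Ov" "Q \<in> Ov" "R \<in> Ov" "U \<in> Ov"
    and dist: "P \<noteq> Q" "P \<noteq> R" "P \<noteq> U" "Q \<noteq> R" "Q \<noteq> U" "R \<noteq> U"
    using xs by auto
  note pl = planes[OF mem(1)] planes[OF mem(2)] planes[OF mem(3)]
  have PQR: "independent3 P Q R" using ind mem dist by blast
  note unique = independent3_unique[OF PQR pl]
  obtain f :: "f8 \<Rightarrow> W" where f: "additive f" "inj f" "range f = U"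
    by (rule plane_parametrization[OF planes[OF mem(4)]])
  have "\<forall>x. \<exists>d. fst d \<in> P \<and> fst (snd d) \<in> Q \<and> snd (snd d) \<in> R \<and>
      f x = fst d + fst (snd d) + snd (snd d)"
  proof
    fix x
    have "f x \<in> {a + b + c | a b c. a \<in> P \<and> b \<in> Q \<and> c \<in> R}"
      using PQR unfolding independent3_iff_spanning[OF W_add_self card_W pl] by blast
    then obtain a b c where "a \<in> P" "b \<in> Q" "c \<in> R" "f x = a + b + c" by blast
    then show "\<exists>d. fst d \<in> P \<and> fst (snd d) \<in> Q \<and> snd (snd d) \<in> R \<and>
      f x = fst d + fst (snd d) + snd (snd d)"
      by (intro exI[of _ "(a, b, c)"]) simp
  qed
  then obtain d where d: "\<And>x. fst (d x) \<in> P \<and> fst (snd (d x)) \<in> Q \<and> snd (snd (d x)) \<in> R \<and>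
      f x = fst (d x) + fst (snd (d x)) + snd (snd (d x))"
    by metis
  define p q r where "p = (\<lambda>x. fst (d x))" "q = (\<lambda>x. fst (snd (d x)))" "r = (\<lambda>x. snd (snd (d x)))"
  have pqr: "p x \<in> P" "q x \<in> Q" "r x \<in> R" and f_eq: "f x = p x + q x + r x" for x
    using d[of x] by (simp_all add: p_q_r_def)
  have sums: "p (x + y) = p x + p y \<and> q (x + y) = q x + q y \<and> r (x + y) = r x + r y" for x y
  proof -
    have "p x + p y \<in> P" "q x + q y \<in> Q" "r x + r y \<in> R"
      using pqr[of x] pqr[of y] pl by (auto simp: plane_def)
    moreover have "p (x + y) + q (x + y) + r (x + y) = (p x + p y) + (q x + q y) + (r x + r y)"
      unfolding f_eq[symmetric] additive.add[OF f(1)] unfolding f_eq by (simp only: add_ac)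
    ultimately show ?thesis
      using unique[OF pqr[of "x + y"]] by blast
  qed
  have add: "additive p" "additive q" "additive r" by standard (simp_all add: sums)
  note zero = additive.zero[OF add(1)] additive.zero[OF add(2)] additive.zero[OF add(3)]
  define h where "h = (\<lambda>(a, b, c). p a + q b + r c)"
  have h_add: "additive h"
    by standard (auto simp: h_def sums add_ac)
  have "x = 0" if "h x = 0" for x
  proof -
    obtain a b c where x: "x = (a, b, c)" by (cases x)
    have "p a + q b + r c = 0" using that by (simp add: x h_def)
    then have z: "p a = 0" "q b = 0" "r c = 0"
      using PQR pqr[of a] pqr[of b] pqr[of c] unfolding independent3_def by blast+
    have f0: "y = 0" if "f y = 0" for y
      using that injD[OF f(2)] additive.zero[OF f(1)] by metis
    have U: "f y \<in> U" for y using f(3) by blast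
    \<comment> \<open>From \<open>p a = 0\<close> it follows that \<open>f a = q a + r a\<close>
      lies in \<open>U\<close> and in \<open>Q + R\<close>, which meet only in 0; likewise for
      \<open>b\<close> and \<open>c\<close>.\<close>
    have "independent3 U Q R" "independent3 P U R" "independent3 P Q U"
      using ind mem dist by blast+
    moreover have "f a + q a + r a = 0" "p b + f b + r b = 0" "p c + q c + f c = 0"
      unfolding f_eq z by (simp_all add: add_ac W_add_left_self)
    ultimately have "f a = 0" "f b = 0" "f c = 0"
      using U pqr unfolding independent3_def by blast+
    then show "x = 0" using f0 by (simp add: x zero_prod_def)
  qed
  then have "inj h" using additive_injI[OF h_add] by blast
  then have bij: "bij h" by (simp add: bij_def finite_UNIV_inj_surj)
  \<comment> \<open>An inclusion between two planes is enough, as both have eight elements.\<close>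
  have h_line: "h ` line v = S" if "plane S" "v \<noteq> 0" "\<And>l. h (smul l v) \<in> S" for v S
    using that plane_image[OF \<open>inj h\<close> h_add plane_line] by (intro plane_eqI) (auto simp: line_def)
  have hs: "h (smul l (1, 0, 0)) = p l" "h (smul l (0, 1, 0)) = q l" "h (smul l (0, 0, 1)) = r l"
    "h (smul l (1, 1, 1)) = f l" for l
    by (simp_all add: h_def zero f_eq)
  have "h ` line (1, 0, 0) = P"
    by (rule h_line[OF pl(1)]) (simp_all only: hs pqr, simp add: zero_prod_def)
  moreover have "h ` line (0, 1, 0) = Q"
    by (rule h_line[OF pl(2)]) (simp_all only: hs pqr, simp add: zero_prod_def)
  moreover have "h ` line (0, 0, 1) = R"
    by (rule h_line[OF pl(3)]) (simp_all only: hs pqr, simp add: zero_prod_def)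
  moreover have "h ` line (1, 1, 1) = U"
    using f(3) by (intro h_line[OF planes[OF mem(4)]]) (simp add: zero_prod_def, simp only: hs, blast)
  ultimately have "inv h ` P = line (1, 0, 0)" "inv h ` Q = line (0, 1, 0)" "inv h ` R = line (0, 0, 1)"
    "inv h ` U = line (1, 1, 1)"
    using image_inv_f_f[OF \<open>inj h\<close>] by metis+
  then have "framed (image (inv h) ` Ov)"
    unfolding framed_def using mem by (metis (no_types, lifting) empty_subsetI image_eqI insert_subset)
  moreover have "lin_equiv Ov (image (inv h) ` Ov)"
    unfolding lin_equiv_def using additive_inv[OF bij h_add] bij_imp_bij_inv[OF bij] by blast
  ultimately show ?thesis by blast
qed

section \<open>Planes as graphs of pairs of additive maps\<close>

definition graph :: "(f8 \<Rightarrow> f8) \<Rightarrow> (f8 \<Rightarrow> f8) \<Rightarrow> W set" where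
  "graph A B = range (\<lambda>x. (x, A x, B x))"

lemma in_graph_iff: "(x, y, z) \<in> graph A B \<longleftrightarrow> y = A x \<and> z = B x"
  by (auto simp: graph_def)

lemma graph_inject: "graph A B = graph A' B' \<longleftrightarrow> A = A' \<and> B = B'"
proof
  assume eq: "graph A B = graph A' B'"
  have "(x, A x, B x) \<in> graph A B" for x by (simp add: in_graph_iff)
  then have "(x, A x, B x) \<in> graph A' B'" for x unfolding eq .
  then show "A = A' \<and> B = B'" by (auto simp: in_graph_iff)
qed simp

lemma axes:
  "(x, 0, 0) \<in> line (1, 0, 0)" "(0, x, 0) \<in> line (0, 1, 0)" "(0, 0, x) \<in> line (0, 0, 1)"
  by (auto simp: line_def)

lemma graph_scalar: "graph (\<lambda>x. t * x) (\<lambda>x. y * x) = line (1, t, y)"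
  by (simp add: graph_def line_def mult.commute)

lemma graph_id: "graph (\<lambda>x. x) (\<lambda>x. x) = line (1, 1, 1)"
  using graph_scalar[of 1 1] by simp

lemma graph_neq_axes: "graph A B \<noteq> line (0, 1, 0)" "graph A B \<noteq> line (0, 0, 1)"
proof -
  have "(1, A 1, B 1) \<in> graph A B" by (simp add: in_graph_iff)
  moreover have "(1, A 1, B 1) \<notin> line (0, 1, 0)" "(1, A 1, B 1) \<notin> line (0, 0, 1)"
    by (auto simp: line_def)
  ultimately show "graph A B \<noteq> line (0, 1, 0)" "graph A B \<noteq> line (0, 0, 1)" by blast+
qed

text \<open>Independence from the last two axes makes the first coordinate injective on
  \<open>S\<close>. As \<open>S\<close> has eight elements it is bijective, so \<open>S\<close> is a
  graph, and closure under addition makes the two maps additive.\<close>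

lemma plane_graph:
  fixes S :: "W set"
  assumes "plane S" "independent3 S (line (0, 1, 0)) (line (0, 0, 1))"
  obtains A B where "additive A" "additive B" "S = graph A B"
proof -
  have cl: "\<And>p q. p \<in> S \<Longrightarrow> q \<in> S \<Longrightarrow> p + q \<in> S" and card: "card S = 8"
    using assms(1) by (auto simp: plane_def)
  have inj: "y = y' \<and> z = z'" if "(x, y, z) \<in> S" "(x, y', z') \<in> S" for x y z y' z'
  proof -
    have "(x, y, z) + (x, y', z') \<in> S" using cl that by blast
    then have "(0, y + y', z + z') \<in> S" by simp
    moreover have "(0 :: f8, y + y', z + z') + (0, y + y', 0) + (0, 0, z + z') = 0"
      by (simp add: zero_prod_def)
    ultimately have "(0, y + y', z + z') = (0 :: W)"
      using assms(2) axes unfolding independent3_def by blast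
    then show ?thesis by (simp add: zero_prod_def f8_add_eq_0_iff)
  qed
  have "inj_on fst S"
  proof (rule inj_onI)
    fix p q assume "p \<in> S" "q \<in> S" "fst p = fst q"
    then show "p = q" by (cases p; cases q) (use inj in auto)
  qed
  then have "card (fst ` S) = card (UNIV :: f8 set)" by (simp add: card_image card card_f8)
  then have surj: "fst ` S = UNIV" by (intro card_subset_eq) simp_all
  have "\<forall>x. \<exists>v. (x, v) \<in> S"
  proof
    fix x
    have "x \<in> fst ` S" using surj by simp
    then show "\<exists>v. (x, v) \<in> S" by force
  qed
  then obtain g where g: "\<And>x. (x, g x) \<in> S" by metis
  define A B where "A = (\<lambda>x. fst (g x))" "B = (\<lambda>x. snd (g x))"
  have AB: "(x, A x, B x) \<in> S" for x using g[of x] by (simp add: A_B_def)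
  have sum: "A (x + y) = A x + A y \<and> B (x + y) = B x + B y" for x y
  proof -
    have "(x, A x, B x) + (y, A y, B y) \<in> S" using cl AB by blast
    then have "(x + y, A x + A y, B x + B y) \<in> S" by simp
    then show ?thesis using inj AB by blast
  qed
  show thesis
  proof
    show "additive A" "additive B" by standard (simp_all add: sum)
    show "S = graph A B"
    proof
      show "graph A B \<subseteq> S" using AB by (auto simp: graph_def)
      show "S \<subseteq> graph A B"
      proof
        fix p assume "p \<in> S"
        moreover obtain x y z where p: "p = (x, y, z)" by (cases p)
        ultimately have "y = A x \<and> z = B x" using inj AB by blast
        then show "p \<in> graph A B" by (simp add: p in_graph_iff)
      qed
    qed
  qed
qed

text \<open>Each forbidden coincidence gives a nontrivial relation: the coordinates that do not
  cancel are absorbed by the axes.\<close>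

lemma independent3_graph_disagree:
  shows "independent3 (graph A B) (line (1, 0, 0)) (line (0, 0, 1)) \<Longrightarrow> disagree A (\<lambda>x. 0)"
    "independent3 (graph A B) (line (1, 0, 0)) (line (0, 1, 0)) \<Longrightarrow> disagree B (\<lambda>x. 0)"
    "independent3 (graph A B) (graph A' B') (line (0, 0, 1)) \<Longrightarrow> disagree A A'"
    "independent3 (graph A B) (graph A' B') (line (0, 1, 0)) \<Longrightarrow> disagree B B'"
    "independent3 (graph A B) (graph A' B') (line (1, 0, 0)) \<Longrightarrow> A x = A' y \<Longrightarrow> B x = B' y \<Longrightarrow> x = 0"
proof -
  have g: "(x, A x, B x) \<in> graph A B" "(x, A' x, B' x) \<in> graph A' B'" for x
    by (simp_all add: in_graph_iff)
  note ind = independent3_def[THEN iffD1, rule_format]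
  show "disagree A (\<lambda>x. 0)" if *: "independent3 (graph A B) (line (1, 0, 0)) (line (0, 0, 1))"
    unfolding disagree_def
  proof (intro allI impI notI)
    fix x assume "x \<noteq> 0" "A x = 0"
    then have "(x, A x, B x) + (x, 0, 0) + (0, 0, B x) = 0" by (simp add: zero_prod_def)
    from ind[OF * g(1) axes(1) axes(3) this] show False using \<open>x \<noteq> 0\<close> by (simp add: zero_prod_def)
  qed
  show "disagree B (\<lambda>x. 0)" if *: "independent3 (graph A B) (line (1, 0, 0)) (line (0, 1, 0))"
    unfolding disagree_def
  proof (intro allI impI notI)
    fix x assume "x \<noteq> 0" "B x = 0"
    then have "(x, A x, B x) + (x, 0, 0) + (0, A x, 0) = 0" by (simp add: zero_prod_def)
    from ind[OF * g(1) axes(1) axes(2) this] show False using \<open>x \<noteq> 0\<close> by (simp add: zero_prod_def)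
  qed
  show "disagree A A'" if *: "independent3 (graph A B) (graph A' B') (line (0, 0, 1))"
    unfolding disagree_def
  proof (intro allI impI notI)
    fix x assume "x \<noteq> 0" "A x = A' x"
    then have "(x, A x, B x) + (x, A' x, B' x) + (0, 0, B x + B' x) = 0" by (simp add: zero_prod_def)
    from ind[OF * g(1) g(2) axes(3) this] show False using \<open>x \<noteq> 0\<close> by (simp add: zero_prod_def)
  qed
  show "disagree B B'" if *: "independent3 (graph A B) (graph A' B') (line (0, 1, 0))"
    unfolding disagree_def
  proof (intro allI impI notI)
    fix x assume "x \<noteq> 0" "B x = B' x"
    then have "(x, A x, B x) + (x, A' x, B' x) + (0, A x + A' x, 0) = 0" by (simp add: zero_prod_def)
    from ind[OF * g(1) g(2) axes(2) this] show False using \<open>x \<noteq> 0\<close> by (simp add: zero_prod_def)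
  qed
  show "x = 0" if *: "independent3 (graph A B) (graph A' B') (line (1, 0, 0))" and "A x = A' y" "B x = B' y"
  proof -
    have "(x, A x, B x) + (y, A' y, B' y) + (x + y, 0, 0) = 0"
      using that(2,3) by (simp add: zero_prod_def)
    from ind[OF * g(1) g(2) axes(1) this] show ?thesis by (simp add: zero_prod_def)
  qed
qed

lemma disagree_one: "disagree f g \<Longrightarrow> f 1 \<noteq> g 1"
  by (simp add: disagree_def)

text \<open>A fifth member is the graph of some \<open>A\<close> and \<open>B\<close>, where
  \<open>A\<close> has neither eigenvalue 0 nor 1. The bijection \<open>j\<close> conjugates
  \<open>A\<close> into a multiplication. Applying \<open>j\<close> to all three coordinates keeps
  each of the four frame members, which consist of all (x, 0, 0), (0, x, 0), (0, 0, x) and (x, x,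
  x).\<close>

lemma framed_scalar:
  assumes "gen_pseudo_oval Ov" "framed Ov"
  shows "\<exists>Ov' s B. lin_equiv Ov Ov' \<and> framed Ov' \<and> (s = alpha \<or> s = alpha + 1) \<and> graph (\<lambda>x. s * x) B \<in> Ov'"
proof -
  have planes: "\<And>S. S \<in> Ov \<Longrightarrow> plane S" and card: "card Ov = 9"
    and ind: "\<And>A B C. A \<in> Ov \<Longrightarrow> B \<in> Ov \<Longrightarrow> C \<in> Ov \<Longrightarrow> A \<noteq> B \<Longrightarrow> A \<noteq> C \<Longrightarrow> B \<noteq> C \<Longrightarrow> independent3 A B C"
    using assms by (auto simp: gen_pseudo_oval_def)
  have fr: "line (1, 0, 0) \<in> Ov" "line (0, 1, 0) \<in> Ov" "line (0, 0, 1) \<in> Ov" "line (1, 1, 1) \<in> Ov"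
    using assms(2) by (simp_all add: framed_def)
  have ne: "line (1, 0, 0) \<noteq> line (0, 1, 0)" "line (1, 0, 0) \<noteq> line (0, 0, 1)" "line (0, 1, 0) \<noteq> line (0, 0, 1)"
    "line (1, 1, 1) \<noteq> line (0, 1, 0)" "line (1, 1, 1) \<noteq> line (0, 0, 1)"
    using graph_neq_axes[of "\<lambda>x. 0" "\<lambda>x. 0"] graph_neq_axes[of "\<lambda>x. x" "\<lambda>x. x"]
      graph_scalar[of 0 0] graph_id line_neq_if_det[of "(0, 1, 0)" "(0, 0, 1)" "(1, 0, 0)"] by simp_all
  have "\<exists>S. S \<in> Ov \<and> S \<notin> set [line (1, 0, 0), line (0, 1, 0), line (0, 0, 1), line (1, 1, 1)]"
  proof (rule ccontr)
    assume "\<not> ?thesis"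
    then have "card Ov \<le> card (set [line (1, 0, 0), line (0, 1, 0), line (0, 0, 1), line (1, 1, 1)])"
      by (intro card_mono) auto
    also have "\<dots> \<le> 4" by (rule order_trans[OF card_length]) simp
    finally show False using card by simp
  qed
  then obtain S where S: "S \<in> Ov" "S \<noteq> line (1, 0, 0)" "S \<noteq> line (0, 1, 0)" "S \<noteq> line (0, 0, 1)" "S \<noteq> line (1, 1, 1)"
    by auto
  obtain A B where AB: "additive A" "additive B" "S = graph A B"
    using plane_graph[OF planes[OF S(1)] ind[OF S(1) fr(2,3) S(3,4) ne(3)]] by blast
  note dis = independent3_graph_disagree[of A B, folded AB(3)]
  have "disagree A (\<lambda>x. 0)"
    by (rule dis(1)[OF ind[OF S(1) fr(1,3) S(2,4) ne(2)]])
  moreover have "disagree A (\<lambda>x. x)"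
    by (rule dis(3)[of "\<lambda>x. x" "\<lambda>x. x", unfolded graph_id, OF ind[OF S(1) fr(4,3) S(5,4) ne(5)]])
  moreover obtain p where p: "A = amap p" using additive_eq_amap[OF AB(1)] by blast
  ultimately obtain q s where q: "\<And>x. A (amap q x) = amap q (s * x)" "disagree (amap q) (\<lambda>x. 0)"
      and s: "s = alpha \<or> s = alpha + 1"
    using amap_conjugate_scalar[rule_format, of p] unfolding p Let_def by blast
  define j where "j = amap q"
  have j_add: "additive j" by (simp add: j_def additive_amap)
  have "inj j" using q(2) by (intro additive_injI[OF j_add]) (auto simp: disagree_def j_def)
  then have j_surj: "surj j" by (simp add: finite_UNIV_inj_surj)
  define J where "J = (\<lambda>(x, y, z). (j x, j y, j z))"
  have J_add: "additive J" by standard (auto simp: J_def additive.add[OF j_add])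
  have "inj J" using \<open>inj j\<close> by (auto simp: J_def inj_def)
  then have J: "bij J" by (simp add: bij_def finite_UNIV_inj_surj)
  have j0: "j 0 = 0" by (rule additive.zero[OF j_add])
  have img: "range (\<lambda>l. k (j l)) = range k" for k :: "f8 \<Rightarrow> W"
  proof -
    have "range (\<lambda>l. k (j l)) = k ` range j" by (simp only: image_image)
    then show ?thesis by (simp only: j_surj)
  qed
  have "J ` line (1, 0, 0) = line (1, 0, 0)" "J ` line (0, 1, 0) = line (0, 1, 0)"
    "J ` line (0, 0, 1) = line (0, 0, 1)" "J ` line (1, 1, 1) = line (1, 1, 1)"
    using img[of "\<lambda>l. (l, 0, 0)"] img[of "\<lambda>l. (0, l, 0)"] img[of "\<lambda>l. (0, 0, l)"] img[of "\<lambda>l. (l, l, l)"]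
    by (simp_all add: line_def image_image J_def j0)
  moreover have "J ` graph (\<lambda>x. s * x) (\<lambda>x. inv j (B (j x))) = graph A B"
    using img[of "\<lambda>l. (l, A l, B l)"]
    by (simp add: graph_def image_image J_def surj_f_inv_f[OF j_surj] q(1)[folded j_def])
  ultimately have inv: "line (1, 0, 0) = inv J ` line (1, 0, 0)" "line (0, 1, 0) = inv J ` line (0, 1, 0)"
    "line (0, 0, 1) = inv J ` line (0, 0, 1)" "line (1, 1, 1) = inv J ` line (1, 1, 1)"
    "graph (\<lambda>x. s * x) (\<lambda>x. inv j (B (j x))) = inv J ` graph A B"
    using image_inv_f_f[OF \<open>inj J\<close>] by metis+
  have "framed (image (inv J) ` Ov)"
    unfolding framed_def insert_subset using fr inv(1-4) by (blast intro: image_eqI)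
  moreover have "graph (\<lambda>x. s * x) (\<lambda>x. inv j (B (j x))) \<in> image (inv J) ` Ov"
    using inv(5) S(1) AB(3) by (blast intro: image_eqI)
  moreover have "lin_equiv Ov (image (inv J) ` Ov)"
    unfolding lin_equiv_def using additive_inv[OF J J_add] bij_imp_bij_inv[OF J] by blast
  ultimately show ?thesis using s by blast
qed

lemma classification_if_scalar:
  assumes po: "gen_pseudo_oval Ov" and "framed Ov" and s: "s = alpha \<or> s = alpha + 1"
    and S0: "graph (\<lambda>x. s * x) B0 \<in> Ov"
  shows "lin_equiv Ov (line ` set conic_points) \<or> lin_equiv Ov (line ` set pointed_conic_points)"
proof -
  have planes: "\<And>S. S \<in> Ov \<Longrightarrow> plane S" and card: "card Ov = 9"
    and ind: "\<And>A B C. A \<in> Ov \<Longrightarrow> B \<in> Ov \<Longrightarrow> C \<in> Ov \<Longrightarrow> A \<noteq> B \<Longrightarrow> A \<noteq> C \<Longrightarrow> B \<noteq> C \<Longrightarrow> independent3 A B C"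
    using po by (auto simp: gen_pseudo_oval_def)
  have fr: "line (1, 0, 0) \<in> Ov" "line (0, 1, 0) \<in> Ov" "line (0, 0, 1) \<in> Ov" "line (1, 1, 1) \<in> Ov"
    using assms(2) by (simp_all add: framed_def)
  have g0: "graph (\<lambda>x. 0) (\<lambda>x. 0) = line (1, 0, 0)" using graph_scalar[of 0 0] by simp
  have ne: "line (1, 0, 0) \<noteq> line (0, 1, 0)" "line (1, 0, 0) \<noteq> line (0, 0, 1)" "line (0, 1, 0) \<noteq> line (0, 0, 1)"
    using graph_neq_axes[of "\<lambda>x. 0" "\<lambda>x. 0"] g0
      line_neq_if_det[of "(0, 1, 0)" "(0, 0, 1)" "(1, 0, 0)"] by simp_all
  \<comment> \<open>\<open>G\<close> describes the six members other than the three axes. The axis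
    (1, 0, 0) is itself a graph, of the zero maps, so it has to be left out explicitly.\<close>
  define G where "G = {(A, B). additive A \<and> additive B \<and> graph A B \<in> Ov \<and> graph A B \<noteq> line (1, 0, 0)}"
  have Ov: "Ov = {line (1, 0, 0), line (0, 1, 0), line (0, 0, 1)} \<union> (\<lambda>(A, B). graph A B) ` G"
  proof (intro set_eqI iffI)
    fix S assume S: "S \<in> Ov"
    show "S \<in> {line (1, 0, 0), line (0, 1, 0), line (0, 0, 1)} \<union> (\<lambda>(A, B). graph A B) ` G"
    proof (rule ccontr)
      assume n: "S \<notin> {line (1, 0, 0), line (0, 1, 0), line (0, 0, 1)} \<union> (\<lambda>(A, B). graph A B) ` G"
      then have "independent3 S (line (0, 1, 0)) (line (0, 0, 1))" using S fr ne ind by blast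
      then obtain A B where "additive A" "additive B" "S = graph A B"
        using plane_graph[OF planes[OF S]] by blast
      then have "(A, B) \<in> G" using S n by (simp add: G_def)
      then show False using n \<open>S = graph A B\<close> by force
    qed
  next
    fix S assume "S \<in> {line (1, 0, 0), line (0, 1, 0), line (0, 0, 1)} \<union> (\<lambda>(A, B). graph A B) ` G"
    then show "S \<in> Ov" using fr by (auto simp: G_def)
  qed
  have "inj_on (\<lambda>(A, B). graph A B) G"
    by (auto simp: inj_on_def graph_inject)
  then have "card ((\<lambda>(A, B). graph A B) ` G) = card G" by (rule card_image)
  moreover have "{line (1, 0, 0), line (0, 1, 0), line (0, 0, 1)} \<inter> (\<lambda>(A, B). graph A B) ` G = {}"
  proof (rule equals0I)
    fix S assume S: "S \<in> {line (1, 0, 0), line (0, 1, 0), line (0, 0, 1)} \<inter> (\<lambda>(A, B). graph A B) ` G"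
    then obtain g where "S = (\<lambda>(A, B). graph A B) g" "g \<in> G" by (rule IntD2[THEN imageE])
    moreover obtain A B where "g = (A, B)" by (cases g)
    ultimately show False using S graph_neq_axes[of A B] by (simp add: G_def)
  qed
  then have "card ({line (1, 0, 0), line (0, 1, 0), line (0, 0, 1)} \<union> (\<lambda>(A, B). graph A B) ` G) =
      card {line (1, 0, 0), line (0, 1, 0), line (0, 0, 1)} + card ((\<lambda>(A, B). graph A B) ` G)"
    by (intro card_Un_disjoint finite)
  moreover have "card {line (1, 0, 0), line (0, 1, 0), line (0, 0, 1)} = 3" using ne by simp
  ultimately have cardG: "card G = 6" unfolding Ov[symmetric] using card by linarith
  have Gex: "\<exists>g. g \<in> G \<and> g \<notin> set gs" if "length gs < 6" for gs
  proof (rule ccontr)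
    assume "\<not> ?thesis"
    then have "card G \<le> card (set gs)" by (intro card_mono) auto
    also have "\<dots> \<le> length gs" by (rule card_length)
    finally show False using that cardG by simp
  qed
  have add: "additive A" "additive B" and mem: "graph A B \<in> Ov" and neq: "graph A B \<noteq> line (1, 0, 0)"
    if "(A, B) \<in> G" for A B
    using that by (simp_all add: G_def)
  note dis = independent3_graph_disagree
  have dis0: "disagree A (\<lambda>x. 0)" "disagree B (\<lambda>x. 0)" if "(A, B) \<in> G" for A B
    using dis(1,2)[of A B] ind mem[OF that] neq[OF that] graph_neq_axes[of A B] fr ne by blast+
  have dis2: "disagree A A'" "disagree B B'" "\<And>x y. A x = A' y \<Longrightarrow> B x = B' y \<Longrightarrow> x = 0"
    if g: "(A, B) \<in> G" "(A', B') \<in> G" "(A, B) \<noteq> (A', B')" for A B A' B'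
  proof -
    have n: "graph A B \<noteq> graph A' B'" using g(3) by (simp add: graph_inject)
    show "disagree A A'"
      by (rule dis(3)[OF ind]) (use g n mem fr graph_neq_axes in auto)
    show "disagree B B'"
      by (rule dis(4)[OF ind]) (use g n mem fr graph_neq_axes in auto)
    have "independent3 (graph A B) (graph A' B') (line (1, 0, 0))"
      by (rule ind) (use g n mem fr neq in auto)
    then show "x = 0" if "A x = A' y" "B x = B' y" for x y
      using that by (rule dis(5))
  qed
  have id: "(\<lambda>x. x, \<lambda>x. x) \<in> G"
  proof -
    have "graph (\<lambda>x. x) (\<lambda>x. x) \<noteq> line (1, 0, 0)"
      unfolding g0[symmetric] graph_inject by (metis one_neq_zero)
    then show ?thesis using fr(4) by (simp add: G_def graph_id additive_def)
  qed
  have s01: "s \<noteq> 0" "s \<noteq> 1" using s by (auto simp: zero_f8_def one_f8_def)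
  have sB: "(\<lambda>x. s * x, B0) \<in> G"
  proof -
    have "graph (\<lambda>x. s * x) B0 \<noteq> line (1, 0, 0)"
      unfolding g0[symmetric] graph_inject using s01(1) by (metis mult.right_neutral)
    then have "graph (\<lambda>x. s * x) B0 \<in> (\<lambda>(A, B). graph A B) ` G"
      using S0 graph_neq_axes unfolding Ov by blast
    then obtain g where "graph (\<lambda>x. s * x) B0 = (\<lambda>(A, B). graph A B) g" "g \<in> G" by (rule imageE)
    moreover obtain A B where "g = (A, B)" by (cases g)
    ultimately show ?thesis by (simp only: prod.case graph_inject)
  qed
  have A_scalar: "\<exists>t. A = (\<lambda>x. t * x)" if g: "(A, B) \<in> G" for A B
  proof (cases "(A, B) \<in> {(\<lambda>x. x, \<lambda>x. x), (\<lambda>x. s * x, B0)}")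
    case True
    moreover have "(\<lambda>x. x) = (\<lambda>x :: f8. 1 * x)" by simp
    ultimately show ?thesis by blast
  next
    case False
    \<comment> \<open>Among the six members there is a fourth one, and its first map is the second
      candidate that \<open>scalar_if_disagree\<close> asks for.\<close>
    obtain A' B' where g': "(A', B') \<in> G" "(A', B') \<notin> set [(\<lambda>x. x, \<lambda>x. x), (\<lambda>x. s * x, B0), (A, B)]"
      using Gex[of "[(\<lambda>x. x, \<lambda>x. x), (\<lambda>x. s * x, B0), (A, B)]"] by auto
    show ?thesis
      by (rule scalar_if_disagree[OF s add(1)[OF g] add(1)[OF g'(1)]])
        (use dis0 dis2(1) g g' id sB False in auto)
  qed
  have B_scalar: "\<exists>y. B = (\<lambda>x. y * x)" if g: "(\<lambda>x. t * x, B) \<in> G" for t B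
  proof (cases "(\<lambda>x. t * x, B) = (\<lambda>x. x, \<lambda>x. x)")
    case True
    moreover have "(\<lambda>x. x) = (\<lambda>x :: f8. 1 * x)" by simp
    ultimately show ?thesis by blast
  next
    case False
    \<comment> \<open>Two further members, different from the unit point, complete a triangle of
      compatible pairs.\<close>
    obtain A' C where g': "(A', C) \<in> G" "(A', C) \<notin> set [(\<lambda>x. x, \<lambda>x. x), (\<lambda>x. t * x, B)]"
      using Gex[of "[(\<lambda>x. x, \<lambda>x. x), (\<lambda>x. t * x, B)]"] by auto
    obtain A'' D where g'': "(A'', D) \<in> G" "(A'', D) \<notin> set [(\<lambda>x. x, \<lambda>x. x), (\<lambda>x. t * x, B), (A', C)]"
      using Gex[of "[(\<lambda>x. x, \<lambda>x. x), (\<lambda>x. t * x, B), (A', C)]"] by auto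
    obtain t' where t': "A' = (\<lambda>x. t' * x)" using A_scalar[OF g'(1)] by blast
    obtain t'' where t'': "A'' = (\<lambda>x. t'' * x)" using A_scalar[OF g''(1)] by blast
    have slope: "u \<noteq> 0 \<and> u \<noteq> 1 \<and> disagree E (\<lambda>x. 0) \<and> disagree E (\<lambda>x. x) \<and> disagree E (\<lambda>x. u * x)"
      if h: "(\<lambda>x. u * x, E) \<in> G" "(\<lambda>x. u * x, E) \<noteq> (\<lambda>x. x, \<lambda>x. x)" for u E
    proof -
      have "u \<noteq> 0" using disagree_one[OF dis0(1)[OF h(1)]] by auto
      moreover have "u \<noteq> 1" using disagree_one[OF dis2(1)[OF h(1) id h(2)]] by auto
      moreover have "disagree E (\<lambda>x. u * x)"
        unfolding disagree_def using dis2(3)[OF h(1) id h(2)] by blast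
      ultimately show ?thesis using dis0(2)[OF h(1)] dis2(2)[OF h(1) id h(2)] by blast
    qed
    have pair: "u \<noteq> v \<and> disagree E E' \<and> disagree (\<lambda>z. E (v * z)) (\<lambda>z. E' (u * z))"
      if h: "(\<lambda>x. u * x, E) \<in> G" "(\<lambda>x. v * x, E') \<in> G" "(\<lambda>x. u * x, E) \<noteq> (\<lambda>x. v * x, E')" for u v E E'
    proof -
      have "u \<noteq> v" using disagree_one[OF dis2(1)[OF h]] by auto
      moreover have "v \<noteq> 0" using disagree_one[OF dis0(1)[OF h(2)]] by auto
      \<comment> \<open>At x = v z and y = u z the first maps agree, as u (v z) = v (u z). If the
        second maps agreed as well, v z would be 0, hence z = 0.\<close>
      then have "disagree (\<lambda>z. E (v * z)) (\<lambda>z. E' (u * z))"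
        using dis2(3)[OF h mult.left_commute] unfolding disagree_def by (metis mult_eq_0_iff)
      ultimately show ?thesis using dis2(2)[OF h] by blast
    qed
    note h' = g'[unfolded t'] and h'' = g''[unfolded t'' t']
    have "(\<lambda>x. t * x, B) \<noteq> (\<lambda>x. t' * x, C)" "(\<lambda>x. t * x, B) \<noteq> (\<lambda>x. t'' * x, D)"
      "(\<lambda>x. t' * x, C) \<noteq> (\<lambda>x. t'' * x, D)" "(\<lambda>x. t' * x, C) \<noteq> (\<lambda>x. x, \<lambda>x. x)" "(\<lambda>x. t'' * x, D) \<noteq> (\<lambda>x. x, \<lambda>x. x)"
      using h'(2) h''(2) unfolding set_simps insert_iff by metis+
    note n = this
    show ?thesis
      using slope[OF g False] slope[OF h'(1) n(4)] slope[OF h''(1) n(5)]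
        pair[OF g h'(1) n(1)] pair[OF g h''(1) n(2)] pair[OF h'(1) h''(1) n(3)]
        add(2)[OF g] add(2)[OF h'(1)] add(2)[OF h''(1)]
      by (intro scalar_if_compatible[of t t' t'' B C D]) blast+
  qed
  define T where "T = {t. \<exists>y. (\<lambda>x. t * x, \<lambda>x. y * x) \<in> G}"
  have "\<forall>t. \<exists>y. t \<in> T \<longrightarrow> (\<lambda>x. t * x, \<lambda>x. y * x) \<in> G"
    by (auto simp: T_def)
  then obtain f where f: "\<And>t. t \<in> T \<Longrightarrow> (\<lambda>x. t * x, \<lambda>x. f t * x) \<in> G" by metis
  have fun_eq: "(\<lambda>x. a * x) = (\<lambda>x. b * x) \<longleftrightarrow> a = b" for a b :: f8
    by (metis mult.right_neutral)
  have G: "G = (\<lambda>t. (\<lambda>x. t * x, \<lambda>x. f t * x)) ` T"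
  proof (intro set_eqI iffI)
    fix g assume g: "g \<in> G"
    obtain A B where AB: "g = (A, B)" by (cases g)
    obtain t where t: "A = (\<lambda>x. t * x)" using A_scalar g AB by blast
    obtain y where y: "B = (\<lambda>x. y * x)" using B_scalar g AB t by blast
    have T: "t \<in> T" using g AB t y by (auto simp: T_def)
    \<comment> \<open>Another member with the same slope would have the same first map, whereas
      first maps of different members disagree.\<close>
    have "g = (\<lambda>x. t * x, \<lambda>x. f t * x)"
    proof (rule ccontr)
      assume "g \<noteq> (\<lambda>x. t * x, \<lambda>x. f t * x)"
      then have "disagree (\<lambda>x. t * x) (\<lambda>x. t * x)"
        using dis2(1) g f[OF T] unfolding AB t by blast
      then show False by (blast dest: disagree_one)
    qed
    then show "g \<in> (\<lambda>t. (\<lambda>x. t * x, \<lambda>x. f t * x)) ` T" using T by blast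
  next
    fix g assume "g \<in> (\<lambda>t. (\<lambda>x. t * x, \<lambda>x. f t * x)) ` T"
    then show "g \<in> G" using f by blast
  qed
  have "inj_on (\<lambda>t. (\<lambda>x. t * x, \<lambda>x. f t * x)) T"
    by (rule inj_onI) (simp only: prod.inject fun_eq)
  then have cardT: "card T = 6" using cardG unfolding G by (simp add: card_image)
  have T0: "0 \<notin> T"
  proof
    assume "0 \<in> T"
    from disagree_one[OF dis0(1)[OF f[OF this]]] show False by simp
  qed
  have T1: "1 \<in> T" "f 1 = 1"
  proof -
    have "(\<lambda>x. 1 * x, \<lambda>x. 1 * x) \<in> G" using id by simp
    then obtain t where "t \<in> T" "(\<lambda>x. 1 * x) = (\<lambda>x. t * x)" "(\<lambda>x. 1 * x) = (\<lambda>x. f t * x)"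
      unfolding G by auto
    then show "1 \<in> T" "f 1 = 1" by (simp_all only: fun_eq)
  qed
  \<comment> \<open>The six slopes leave two elements of the field, one of which is 0; the other is
    the missing slope \<open>m\<close>.\<close>
  have "card (- T) = 2" using cardT card_f8 by (simp add: Compl_eq_Diff_UNIV card_Diff_subset)
  then obtain a b where ab: "- T = {a, b}" "a \<noteq> b" by (auto simp: card_2_iff)
  have "0 \<in> {a, b}" using T0 ab by blast
  then obtain m where m0: "- T = {0, m}" "m \<noteq> 0"
    using ab by (metis insert_commute insertE singletonD)
  then have mem_T: "t \<in> T \<longleftrightarrow> t \<noteq> 0 \<and> t \<noteq> m" for t by blast
  then have T: "T = {t. t \<noteq> 0 \<and> t \<noteq> m}" and "m \<noteq> 1" using T1(1) by blast+
  have gf: "graph (\<lambda>x. t * x) (\<lambda>x. f t * x) = line (1, t, f t)" for t by (rule graph_scalar)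
  have Ovl: "Ov = line ` ({(1, 0, 0), (0, 1, 0), (0, 0, 1)} \<union> (\<lambda>t. (1, t, f t)) ` T)"
    unfolding Ov G by (simp add: image_Un image_image gf)
  have distinct: "(\<lambda>x. t * x, \<lambda>x. f t * x) \<noteq> (\<lambda>x. t' * x, \<lambda>x. f t' * x)" if "t \<noteq> t'" for t t'
    using that by (simp only: prod.inject fun_eq simp_thms)
  have "slope_arc T f"
    unfolding slope_arc_def
  proof (intro ballI conjI impI)
    fix t assume t: "t \<in> T"
    show "f t \<noteq> 0" using disagree_one[OF dis0(2)[OF f[OF t]]] by auto
    fix t' assume t': "t' \<in> T" "t \<noteq> t'"
    note d = dis2[OF f[OF t] f[OF t'(1)] distinct[OF t'(2)]]
    show "f t \<noteq> f t'" using disagree_one[OF d(2)] by auto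
    show "t' * f t \<noteq> t * f t'"
    proof
      assume "t' * f t = t * f t'"
      then have "t' = 0" using d(3)[of t' t] by (simp add: mult.commute)
      then show False using t'(1) T0 by blast
    qed
    fix t'' assume t'': "t'' \<in> T" "t \<noteq> t'' \<and> t' \<noteq> t''"
    show "(t'' + t') * f t + (t'' + t) * f t' + (t' + t) * f t'' \<noteq> 0"
    proof
      assume eq: "(t'' + t') * f t + (t'' + t) * f t' + (t' + t) * f t'' = 0"
      have "line (1, t, f t) \<noteq> line (1, t', f t')" "line (1, t, f t) \<noteq> line (1, t'', f t'')"
        "line (1, t', f t') \<noteq> line (1, t'', f t'')"
        unfolding gf[symmetric] graph_inject fun_eq using t'(2) t''(2) by blast+
      moreover have "line (1, u, f u) \<in> Ov" if "u \<in> T" for u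
        unfolding gf[symmetric] using mem[OF f[OF that]] .
      ultimately have "independent3 (line (1, t, f t)) (line (1, t', f t')) (line (1, t'', f t''))"
        using ind t t' t'' by blast
      \<comment> \<open>The coefficients are the cofactors of the third column of the determinant.
        The first two coordinates cancel identically in characteristic 2, and the third is the
        assumed equation.\<close>
      moreover have "smul (t'' + t') (1, t, f t) + smul (t'' + t) (1, t', f t') + smul (t' + t) (1, t'', f t'') = 0"
        unfolding smul.simps add_Pair eq by (simp only: f8_ring_simps mult_1_right mult_1_left zero_prod_def)
      ultimately have "smul (t'' + t') (1, t, f t) = 0"
        unfolding independent3_def line_def by blast
      then have "t'' + t' = 0" by (simp add: zero_prod_def)
      then show False using t''(2) by (simp add: f8_add_eq_0_iff)
    qed
  qed
  then show ?thesis
    using oval_lin_equiv[of m f, folded T, folded Ovl] m0(2) \<open>m \<noteq> 1\<close> T1(2) card by blast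
qed

lemma gen_pseudo_oval_classification:
  fixes Ov :: "W set set"
  assumes "gen_pseudo_oval Ov"
  shows "lin_equiv Ov (line ` set conic_points) \<or> lin_equiv Ov (line ` set pointed_conic_points)"
proof -
  obtain O1 where O1: "lin_equiv Ov O1" "framed O1" using gen_pseudo_oval_framed[OF assms] by blast
  have "gen_pseudo_oval O1" using gen_pseudo_oval_lin_equiv[OF O1(1) assms] .
  then obtain O2 s B where O2: "lin_equiv O1 O2" "framed O2" "s = alpha \<or> s = alpha + 1"
    "graph (\<lambda>x. s * x) B \<in> O2"
    using framed_scalar O1(2) by blast
  have "gen_pseudo_oval O2" using gen_pseudo_oval_lin_equiv[OF O2(1) \<open>gen_pseudo_oval O1\<close>] .
  then have "lin_equiv O2 (line ` set conic_points) \<or> lin_equiv O2 (line ` set pointed_conic_points)"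
    using classification_if_scalar O2(2-4) by blast
  then show ?thesis using O1(1) O2(1) lin_equiv_trans by metis
qed

section \<open>Inequivalence of the two pseudo-ovals\<close>

text \<open>Here \<open>p + q\<close> ranges over \<open>(P + Q) \<inter> (R + S)\<close> and \<open>p' + r'\<close> over \<open>(P + R) \<inter> (Q + S)\<close>:
  these are two diagonal points of the quadrangle, and in characteristic 2 the third one is
  collinear with them.\<close>

definition on_diagonal_line ::
    "'a::ab_group_add set \<Rightarrow> 'a set \<Rightarrow> 'a set \<Rightarrow> 'a set \<Rightarrow> 'a set \<Rightarrow> bool" where
  "on_diagonal_line E P Q R S \<longleftrightarrow>
     (\<exists>p\<in>P. \<exists>q\<in>Q. \<exists>r\<in>R. \<exists>s\<in>S. \<exists>p'\<in>P. \<exists>q'\<in>Q. \<exists>r'\<in>R. \<exists>s'\<in>S.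
        p + q + r + s = 0 \<and> p' + q' + r' + s' = 0 \<and> p + q + p' + r' \<in> E \<and> p + q + p' + r' \<noteq> 0)"

text \<open>Only sums and membership enter, no multiplication of the field, so additive bijections
  preserve the notion.\<close>

definition translation_element :: "'a::ab_group_add set set \<Rightarrow> 'a set \<Rightarrow> bool" where
  "translation_element Ov E \<longleftrightarrow> (\<forall>P\<in>Ov. \<forall>Q\<in>Ov. \<forall>R\<in>Ov. distinct [E, P, Q, R] \<longrightarrow>
     (\<exists>S\<in>Ov. distinct [E, P, Q, R, S] \<and> on_diagonal_line E P Q R S))"

lemma on_diagonal_lineI:
  assumes "p \<in> P" "q \<in> Q" "r \<in> R" "s \<in> S" "p' \<in> P" "q' \<in> Q" "r' \<in> R" "s' \<in> S"
    "p + q + r + s = 0" "p' + q' + r' + s' = 0" "p + q + p' + r' \<in> E" "p + q + p' + r' \<noteq> 0"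
  shows "on_diagonal_line E P Q R S"
  unfolding on_diagonal_line_def using assms by (intro bexI conjI)

lemma on_diagonal_line_image:
  assumes "inj g" "additive g" "on_diagonal_line E P Q R S"
  shows "on_diagonal_line (g ` E) (g ` P) (g ` Q) (g ` R) (g ` S)"
proof -
  interpret additive g by fact
  obtain p q r s p' q' r' s' where *: "p \<in> P" "q \<in> Q" "r \<in> R" "s \<in> S" "p' \<in> P" "q' \<in> Q" "r' \<in> R" "s' \<in> S"
    and sums: "p + q + r + s = 0" "p' + q' + r' + s' = 0" "p + q + p' + r' \<in> E" "p + q + p' + r' \<noteq> 0"
    using assms(3) unfolding on_diagonal_line_def by blast
  have "g p + g q + g r + g s = 0" "g p' + g q' + g r' + g s' = 0"
    by (simp_all only: add[symmetric] sums zero)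
  moreover have "g p + g q + g p' + g r' \<in> g ` E"
    using sums(3) by (simp only: add[symmetric]) blast
  moreover have "g p + g q + g p' + g r' \<noteq> 0"
    unfolding add[symmetric] using sums(4) assms(1) zero by (metis injD)
  ultimately show ?thesis
    unfolding on_diagonal_line_def using * by (meson imageI)
qed

lemma translation_element_image:
  assumes "bij g" "additive g" "translation_element Ov E"
  shows "translation_element (image g ` Ov) (g ` E)"
  unfolding translation_element_def
proof (intro ballI impI)
  have inj: "inj g" using assms(1) by (rule bij_is_inj)
  have dist: "distinct (map (image g) Xs) \<longleftrightarrow> distinct Xs" for Xs
    using inj by (simp add: distinct_map inj_on_def inj_image_eq_iff)
  fix P' Q' R' assume "P' \<in> image g ` Ov" "Q' \<in> image g ` Ov" "R' \<in> image g ` Ov" and d: "distinct [g ` E, P', Q', R']"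
  then obtain P Q R where PQR: "P \<in> Ov" "Q \<in> Ov" "R \<in> Ov" "P' = g ` P" "Q' = g ` Q" "R' = g ` R" by blast
  have "distinct [E, P, Q, R]" using d dist[of "[E, P, Q, R]"] by (simp only: PQR list.map)
  then obtain S where S: "S \<in> Ov" "distinct [E, P, Q, R, S]" "on_diagonal_line E P Q R S"
    using assms(3) PQR(1-3) unfolding translation_element_def by blast
  have "distinct [g ` E, P', Q', R', g ` S]"
    using S(2) dist[of "[E, P, Q, R, S]"] by (simp only: PQR list.map)
  moreover have "on_diagonal_line (g ` E) P' Q' R' (g ` S)"
    unfolding PQR by (rule on_diagonal_line_image[OF inj assms(2) S(3)])
  ultimately show "\<exists>S\<in>image g ` Ov. distinct [g ` E, P', Q', R', S] \<and> on_diagonal_line (g ` E) P' Q' R' S"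
    using S(1) by blast
qed

section \<open>Translation elements of the two ovals\<close>

lemma line_inject: "line (1, a, b) = line (1, c, d) \<longleftrightarrow> a = c \<and> b = d"
proof -
  have fun_eq: "(\<lambda>x. a * x) = (\<lambda>x. b * x) \<longleftrightarrow> a = b" for a b :: f8
    by (metis mult.right_neutral)
  show ?thesis unfolding graph_scalar[symmetric] graph_inject fun_eq ..
qed

lemma conic_lines: "line ` set conic_points = insert (line (0, 1, 0)) (range (\<lambda>t. line (1, t, (t * t) * (t * t))))"
  by (simp add: conic_points_def enum_UNIV image_image)

lemma pointed_conic_lines:
  "line ` set pointed_conic_points = insert (line (0, 1, 0)) (range (\<lambda>t. line (1, t, t * t)))"
  by (simp add: pointed_conic_points_def enum_UNIV image_image)

text \<open>If the sum were 0, then u^3 = w^3; but cubing is injective on a group of order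
  7.\<close>

lemma fourth_power_ratio_inject:
  "\<forall>u w :: f8. u \<noteq> 0 \<and> w \<noteq> 0 \<and> u \<noteq> w \<longrightarrow> (w * w) * (w * w) * u + (u * u) * (u * u) * w \<noteq> 0"
  by code_simp

lemma smul_in_line: "smul l p \<in> line p"
  by (simp add: line_def)

text \<open>The map t -> t^4 is additive, so the points with parameters a, b, c and e = a + b + c
  add up to 0. This gives the diagonal points (0, a + b, \<open>q (a + b)\<close>) and (0, a + c,
  \<open>q (a + c)\<close>), whose joining line contains (0, 1, 0).\<close>

lemma translation_element_conic: "translation_element (line ` set conic_points) (line (0, 1, 0))"
  unfolding translation_element_def
proof (intro ballI impI)
  define q :: "f8 \<Rightarrow> f8" where "q = (\<lambda>x. (x * x) * (x * x))"
  have q_add: "q (x + y) = q x + q y" for x y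
    unfolding q_def by (simp only: f8_ring_simps)
  fix P Q R assume mem: "P \<in> line ` set conic_points" "Q \<in> line ` set conic_points" "R \<in> line ` set conic_points"
    and d: "distinct [line (0, 1, 0), P, Q, R]"
  have "\<exists>t. X = line (1, t, q t)" if "X \<in> line ` set conic_points" "X \<noteq> line (0, 1, 0)" for X
    using that unfolding conic_lines q_def by blast
  then obtain a b c where abc: "P = line (1, a, q a)" "Q = line (1, b, q b)" "R = line (1, c, q c)"
    using mem d by (metis distinct_length_2_or_more)
  have ne: "a \<noteq> b" "a \<noteq> c" "b \<noteq> c" using d unfolding abc by auto
  define e where "e = a + b + c"
  have "a \<noteq> e" "b \<noteq> e" "c \<noteq> e"
  proof -
    show "a \<noteq> e" unfolding e_def using ne(3) by (metis add.assoc add.right_neutral add_left_cancel f8_add_eq_0_iff)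
    show "b \<noteq> e" unfolding e_def using ne(2)
      by (metis add.assoc add.commute add.right_neutral add_left_cancel f8_add_eq_0_iff)
    show "c \<noteq> e" unfolding e_def using ne(1)
      by (metis add.commute add.right_neutral add_left_cancel f8_add_eq_0_iff)
  qed
  define S where "S = line (1, e, q e)"
  have S: "S \<in> line ` set conic_points" unfolding S_def conic_lines q_def by blast
  have "line (0, 1, 0) \<noteq> S"
    unfolding S_def using graph_neq_axes(1) by (metis graph_scalar)
  then have dist: "distinct [line (0, 1, 0), P, Q, R, S]"
    using d \<open>a \<noteq> e\<close> \<open>b \<noteq> e\<close> \<open>c \<noteq> e\<close> unfolding abc S_def by (simp add: line_inject)
  define v :: "f8 \<Rightarrow> W" where "v = (\<lambda>t. (1, t, q t))"
  \<comment> \<open>With these multipliers the third coordinates of the two diagonal points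
    cancel.\<close>
  define k l where "k = q (a + c)" "l = q (a + b)"
  have zero: "smul m (v a) + smul m (v b) + smul m (v c) + smul m (v e) = 0" for m
    unfolding v_def e_def q_add smul.simps add_Pair zero_prod_def by (simp only: f8_ring_simps)
  have sum: "smul k (v a) + smul k (v b) + smul l (v a) + smul l (v c) = smul (k * (a + b) + l * (a + c)) (0, 1, 0)"
    unfolding v_def k_l_def q_add smul.simps add_Pair by (simp only: f8_ring_simps mult_1_left mult_1_right mult_zero_left mult_zero_right)
  have "a + b \<noteq> 0" "a + c \<noteq> 0" "a + b \<noteq> a + c"
    using ne by (simp_all add: f8_add_eq_0_iff)
  then have nz: "k * (a + b) + l * (a + c) \<noteq> 0"
    using fourth_power_ratio_inject unfolding k_l_def q_def by blast
  have "on_diagonal_line (line (0, 1, 0)) (line (v a)) (line (v b)) (line (v c)) (line (v e))"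
  proof (rule on_diagonal_lineI[OF _ _ _ _ _ _ _ _ zero[of k] zero[of l]])
    show "smul k (v a) + smul k (v b) + smul l (v a) + smul l (v c) \<in> line (0, 1, 0)"
      unfolding sum by (rule smul_in_line)
    show "smul k (v a) + smul k (v b) + smul l (v a) + smul l (v c) \<noteq> 0"
      unfolding sum smul_eq_0_iff using nz by (simp add: zero_prod_def)
  qed (rule smul_in_line)+
  then have "on_diagonal_line (line (0, 1, 0)) P Q R S" unfolding abc S_def v_def .
  then show "\<exists>S\<in>line ` set conic_points. distinct [line (0, 1, 0), P, Q, R, S] \<and>
      on_diagonal_line (line (0, 1, 0)) P Q R S"
    using S dist by blast
qed

text \<open>The quadrangle is (0, 1, 0), (1, 1, 1), (1, \<open>alpha\<close>,
  \<open>alpha\<close>^2), (1, t, t^2). The coefficients of its last two points are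
  \<open>a\<close>, \<open>b\<close> in one vanishing sum and \<open>c\<close>, \<open>d\<close> in
  another; the remaining coefficients are eliminated. If the second and third coordinates of a point
  on the diagonal line vanish, so does the first, hence the line misses (1, 0, 0).\<close>

lemma no_diagonal_solution:
  "\<forall>t. if t = 0 \<or> t = 1 \<or> t = alpha then True else
     \<forall>a b. if a + b + a * (alpha * alpha) + b * (t * t) \<noteq> 0 then True else
       \<forall>c d. if c + d + c * (alpha * alpha) + d * (t * t) \<noteq> 0 then True else
         if a + b + c * (alpha * alpha) \<noteq> 0 then True else
         a * alpha + b * t + (c + d + c * alpha + d * t) + c * alpha = 0 \<longrightarrow> a + b + c = 0"
  by code_simp

lemma not_translation_element_pointed_conic:
  "\<not> translation_element (line ` set pointed_conic_points) (line (1, 0, 0))"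
proof
  assume *: "translation_element (line ` set pointed_conic_points) (line (1, 0, 0))"
  \<comment> \<open>For this triple no choice of the fourth member works.\<close>
  define P Q R where "P = line (0, 1, 0)" "Q = line (1, 1, 1)" "R = line (1, alpha, alpha * alpha)"
  have ax: "line (1, u, v) \<noteq> line (0, 1, 0)" for u v
    using graph_neq_axes(1) by (metis graph_scalar)
  have mem: "P \<in> line ` set pointed_conic_points" "Q \<in> line ` set pointed_conic_points" "R \<in> line ` set pointed_conic_points"
    unfolding P_Q_R_def pointed_conic_lines
    by (rule insertI1, rule insertI2, rule range_eqI[of _ _ 1], simp, rule insertI2, rule rangeI)
  have "alpha \<noteq> 0" "alpha \<noteq> 1" by (simp_all add: zero_f8_def one_f8_def)
  then have "distinct [line (1, 0, 0), P, Q, R]"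
    using ax ax[symmetric] unfolding P_Q_R_def by (simp add: line_inject del: times_f8.simps)
  then obtain S where S: "S \<in> line ` set pointed_conic_points" "distinct [line (1, 0, 0), P, Q, R, S]"
    "on_diagonal_line (line (1, 0, 0)) P Q R S"
    using * mem unfolding translation_element_def by blast
  have S_ne: "line (1, 0, 0) \<noteq> S" "P \<noteq> S" "Q \<noteq> S" "R \<noteq> S" using S(2) by simp_all
  then obtain t where t: "S = line (1, t, t * t)"
    using S(1) unfolding pointed_conic_lines P_Q_R_def by blast
  have t_ne: "t \<noteq> 0" "t \<noteq> 1" "t \<noteq> alpha"
    using S_ne unfolding t P_Q_R_def line_inject by auto
  obtain p q r s p' q' r' s' where mem': "p \<in> P" "q \<in> Q" "r \<in> R" "s \<in> S" "p' \<in> P" "q' \<in> Q" "r' \<in> R" "s' \<in> S"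
    and sums: "p + q + r + s = 0" "p' + q' + r' + s' = 0" "p + q + p' + r' \<in> line (1, 0, 0)" "p + q + p' + r' \<noteq> 0"
    using S(3) unfolding on_diagonal_line_def by blast
  obtain a1 a2 a3 a4 b1 b2 b3 b4 l where
    coords: "p = smul a1 (0, 1, 0)" "q = smul a2 (1, 1, 1)" "r = smul a3 (1, alpha, alpha * alpha)" "s = smul a4 (1, t, t * t)"
      "p' = smul b1 (0, 1, 0)" "q' = smul b2 (1, 1, 1)" "r' = smul b3 (1, alpha, alpha * alpha)" "s' = smul b4 (1, t, t * t)"
      "p + q + p' + r' = smul l (1, 0, 0)"
    using mem' sums(3) unfolding t P_Q_R_def line_def by (elim rangeE)
  have
    a: "smul a1 (0, 1, 0) + smul a2 (1, 1, 1) + smul a3 (1, alpha, alpha * alpha) + smul a4 (1, t, t * t) = 0"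
    and b: "smul b1 (0, 1, 0) + smul b2 (1, 1, 1) + smul b3 (1, alpha, alpha * alpha) + smul b4 (1, t, t * t) = 0"
    and l: "smul a1 (0, 1, 0) + smul a2 (1, 1, 1) + smul b1 (0, 1, 0) + smul b3 (1, alpha, alpha * alpha) = smul l (1, 0, 0)"
      "smul l (1, 0, 0) \<noteq> 0"
    using sums(1,2) coords(9) sums(4)[unfolded coords(9)] unfolding coords(1-8) by blast+
  define A where "A = alpha"
  note eqs = a b l(1)
  have e: "a2 + a3 + a4 = 0" "a1 + a2 + a3 * A + a4 * t = 0" "a2 + a3 * (A * A) + a4 * (t * t) = 0"
    "b2 + b3 + b4 = 0" "b1 + b2 + b3 * A + b4 * t = 0" "b2 + b3 * (A * A) + b4 * (t * t) = 0"
    "a2 + b3 = l" "a1 + a2 + b1 + b3 * A = 0" "a2 + b3 * (A * A) = 0"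
    using eqs unfolding A_def[symmetric] smul.simps add_Pair zero_prod_def prod.inject
    by (simp_all only: mult_zero_right mult_1_right add_0_left add_0_right)
  have elim: "x = y + z" if "x + y + z = 0" for x y z :: f8
    using that by (metis add.assoc f8_add_eq_0_iff)
  \<comment> \<open>The first two coordinates of both vanishing sums determine the coefficients at
    \<open>P\<close> and \<open>Q\<close>, which leaves the four unknowns of
    \<open>no_diagonal_solution\<close>.\<close>
  have a2: "a2 = a3 + a4" and b2: "b2 = b3 + b4" using elim e(1,4) by blast+
  have a1: "a1 = a2 + (a3 * A + a4 * t)" and b1: "b1 = b2 + (b3 * A + b4 * t)"
    using e(2,5) elim[of a1 a2] elim[of b1 b2] by (simp_all only: add.assoc)
  have "a3 + a4 + a3 * (A * A) + a4 * (t * t) = 0" "b3 + b4 + b3 * (A * A) + b4 * (t * t) = 0"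
    "a3 + a4 + b3 * (A * A) = 0"
    using e(3,6,9) unfolding a2 b2 .
  moreover have "a3 * A + a4 * t + (b3 + b4 + b3 * A + b4 * t) + b3 * A = 0"
    using e(8) unfolding a1 b1 a2 b2 by (simp only: f8_ring_simps)
  ultimately have "a3 + a4 + b3 = 0"
    using no_diagonal_solution t_ne unfolding A_def[symmetric] by metis
  then have "l = 0" using e(7) unfolding a2 by simp
  then show False using l(2) by (simp add: zero_prod_def)
qed

text \<open>Squaring is additive, so t -> s + t extends to a linear map that preserves the pointed
  conic, fixes (0, 1, 0) and takes (1, s, s^2) to (1, 0, 0). Every other member is thus reduced to
  the one already excluded.\<close>

lemma translation_element_pointed_conic_unique:
  assumes "E \<in> line ` set pointed_conic_points" "translation_element (line ` set pointed_conic_points) E"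
  shows "E = line (0, 1, 0)"
proof (rule ccontr)
  assume "E \<noteq> line (0, 1, 0)"
  then obtain s where E: "E = line (1, s, s * s)" using assms(1) unfolding pointed_conic_lines by blast
  define g where "g = lin ((1, s, s * s), (0, 1, 0), (0, 0, 1))"
  have bij: "bij g" unfolding g_def by (rule bij_lin) simp
  have add: "additive g" unfolding g_def by (rule additive_lin)
  have point: "g ` line (1, t, t * t) = line (1, s + t, (s + t) * (s + t))" for t
  proof -
    have "lin ((1, s, s * s), (0, 1, 0), (0, 0, 1)) (1, t, t * t) = (1, s + t, (s + t) * (s + t))"
      unfolding lin.simps smul.simps add_Pair
      by (simp only: f8_ring_simps mult_1_left mult_1_right mult_zero_left mult_zero_right)
    then show ?thesis unfolding g_def lin_line by simp
  qed
  have "surj (\<lambda>t. s + t)" by (rule surjI[of _ "\<lambda>t. s + t"]) simp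
  moreover have "range (\<lambda>t. line (1, s + t, (s + t) * (s + t))) =
      (\<lambda>t. line (1, t, t * t)) ` range (\<lambda>t. s + t)"
    by (simp only: image_image)
  ultimately have "range (\<lambda>t. line (1, s + t, (s + t) * (s + t))) = range (\<lambda>t. line (1, t, t * t))"
    by (simp only:)
  moreover have "g ` line (0, 1, 0) = line (0, 1, 0)"
    unfolding g_def lin_line by simp
  ultimately have "image g ` line ` set pointed_conic_points = line ` set pointed_conic_points"
    unfolding pointed_conic_lines by (simp add: image_image point)
  moreover have "g ` E = line (1, 0, 0)" unfolding E point by simp
  ultimately show False
    using translation_element_image[OF bij add assms(2)] not_translation_element_pointed_conic by simp
qed

text \<open>The members (0, 1, 0) and (1, 0, 0) of the conic are both translation elements. An
  equivalence would send both to the only possible translation element of the pointed conic,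
  contrary to injectivity.\<close>

lemma conic_not_lin_equiv_pointed_conic:
  "\<not> lin_equiv (line ` set conic_points) (line ` set pointed_conic_points)"
proof
  assume "lin_equiv (line ` set conic_points) (line ` set pointed_conic_points)"
  then obtain g where g: "bij g" "additive g" "line ` set pointed_conic_points = image g ` line ` set conic_points"
    by (auto simp: lin_equiv_def)
  define h where "h = lin ((0, 1, 0), (1, 0, 0), (0, 0, 1))"
  have h: "bij h" "image h ` line ` set conic_points = line ` set conic_points"
    unfolding h_def using carries_image[OF conic_swap_carries gen_pseudo_oval_conic(2) refl] by blast+
  have "h ` line (0, 1, 0) = line (1, 0, 0)" unfolding h_def lin_line by simp
  then have "translation_element (line ` set conic_points) (line (1, 0, 0))"
    using translation_element_image[OF h(1) _ translation_element_conic] h(2) additive_lin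
    unfolding h_def by metis
  moreover have "g ` E = line (0, 1, 0)"
    if "E \<in> line ` set conic_points" "translation_element (line ` set conic_points) E" for E
  proof (rule translation_element_pointed_conic_unique)
    show "g ` E \<in> line ` set pointed_conic_points" unfolding g(3) using that(1) by (rule imageI)
    show "translation_element (line ` set pointed_conic_points) (g ` E)"
      unfolding g(3) by (rule translation_element_image[OF g(1,2) that(2)])
  qed
  moreover have "line (0, 1, 0) \<in> line ` set conic_points" "line (1, 0, 0) \<in> line ` set conic_points"
    unfolding conic_lines by (rule insertI1, rule insertI2, rule range_eqI[of _ _ 0], simp)
  ultimately have "g ` line (1, 0, 0) = line (0, 1, 0)" "g ` line (0, 1, 0) = line (0, 1, 0)"
    using translation_element_conic by blast+
  then have "line (1, 0, 0) = line (0, 1, 0)"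
    using bij_is_inj[OF g(1)] by (metis inj_image_eq_iff)
  moreover have "line (1, 0, 0) \<noteq> line (0, 1, 0)"
    using line_neq_if_det[of "(1, 0, 0)" "(0, 1, 0)" "(0, 0, 1)"] by simp
  ultimately show False by blast
qed

theorem theorem5:
  shows "pseudo_oval (elementary conic) \<and> pseudo_oval (elementary pointed_conic) \<and>
         \<not> proj_equiv (elementary conic) (elementary pointed_conic) \<and>
         (\<forall>Ov. pseudo_oval Ov \<longrightarrow>
              proj_equiv Ov (elementary conic) \<or> proj_equiv Ov (elementary pointed_conic))"
proof -
  note conic = lin_equiv_elementary[OF conic_embW]
  note pointed = lin_equiv_elementary[OF pointed_conic_embW]
  have "gen_pseudo_oval (elementary conic)" "gen_pseudo_oval (elementary pointed_conic)"
    using gen_pseudo_oval_lin_equiv conic pointed gen_pseudo_oval_conic(1) gen_pseudo_oval_pointed_conic(1) by blast+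
  moreover have "\<not> lin_equiv (elementary conic) (elementary pointed_conic)"
    using conic_not_lin_equiv_pointed_conic lin_equiv_trans[OF lin_equiv_trans[OF conic] lin_equiv_sym[OF pointed]]
    by blast
  moreover have "lin_equiv Ov (elementary conic) \<or> lin_equiv Ov (elementary pointed_conic)"
    if "gen_pseudo_oval Ov" for Ov :: "V set set"
  proof -
    \<comment> \<open>The classification is available over \<open>W\<close>, so the pseudo-oval is
      pulled back along \<open>embW\<close> and the resulting equivalences are composed.\<close>
    have e: "lin_equiv Ov (image (inv embW) ` Ov)"
      unfolding lin_equiv_def using bij_imp_bij_inv[OF bij_embW] additive_inv[OF bij_embW additive_embW] by blast
    have "lin_equiv (image (inv embW) ` Ov) (line ` set conic_points) \<or>
        lin_equiv (image (inv embW) ` Ov) (line ` set pointed_conic_points)"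
      by (rule gen_pseudo_oval_classification[OF gen_pseudo_oval_lin_equiv[OF e that]])
    then show ?thesis
      using lin_equiv_trans[OF lin_equiv_trans[OF e _] conic] lin_equiv_trans[OF lin_equiv_trans[OF e _] pointed]
      by blast
  qed
  ultimately show ?thesis
    unfolding pseudo_oval_iff_gen_pseudo_oval proj_equiv_iff_lin_equiv by blast
qed

end
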